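(* Fix integers $r\ge1$, $k\ge2$, $b\ge0$ with $\binom{k+b}{k}\le r<\binom{k+b+1}{k}$. Write $U_j=U_j\!\left(\frac{1-x}{2\sqrt x}\right)$. Then $$\sum_{\pi}x^{|\pi|}=\sum\ \prod_{i=0}^{b}\binom{l_i+l_{i+1}+m_i-1}{l_{i+1}+m_i}\binom{l_{i+1}+m_i}{m_i}\ \frac{U_{k-2}^{\,l_0-1}}{U_{k-1}^{\,l_0+1}}\ x^{\frac12(1-l_0)+\sum_{j=0}^{b}(l_j+m_j)},$$ where the sum on the left is over all $\pi\in\mathfrak S(1243,2143)$ containing exactly $r$ subsequences of type $12\ldots k$, and the sum on the right is over all sequences of nonnegative integers $l_0,\dots,l_b$ and $m_0,\dots,m_b$ with $r=\sum_{i=0}^{b}(l_i+m_i)\binom{k+i-1}{k-1}$; here $l_{b+1}=0$, and the conventions $\binom{a}{0}=1$, $\binom{a}{-1}=0$ are used for every integer $a$.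
   Context: $\mathfrak S(1243,2143)$ is the set of all permutations (of any length, including empty) having no subsequence with the same relative order as $1243$ nor as $2143$. A subsequence of type $12\ldots k$ is an increasing subsequence of length $k$; $|\pi|$ is the length of $\pi$. $U_n$ is the Chebyshev polynomial of the second kind: $U_{-1}=0$, $U_0=1$, $U_n(y)=2yU_{n-1}(y)-U_{n-2}(y)$. *)

theory Defs
  imports Complex_Main
begin

definition is_perm :: "nat list \<Rightarrow> bool" where
  "is_perm p \<longleftrightarrow> distinct p \<and> set p = {1..length p}"

definition contains_pattern :: "nat list \<Rightarrow> nat list \<Rightarrow> bool" where
  "contains_pattern s p \<longleftrightarrow>
     (\<exists>idx :: nat list. length idx = length s \<and> sorted_wrt (<) idx \<and>
        (\<forall>i\<in>set idx. i < length p) \<and>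
        (\<forall>a<length s. \<forall>c<length s. (s!a < s!c) \<longleftrightarrow> (p!(idx!a) < p!(idx!c))))"

definition Av_1243_2143 :: "nat list set" where
  "Av_1243_2143 = {p. is_perm p \<and> \<not> contains_pattern [1,2,4,3] p \<and> \<not> contains_pattern [2,1,4,3] p}"

definition inc_count :: "nat \<Rightarrow> nat list \<Rightarrow> nat" where
  "inc_count k p = card {S. S \<subseteq> {..<length p} \<and> card S = k \<and>
                           (\<forall>i\<in>S. \<forall>j\<in>S. i < j \<longrightarrow> p!i < p!j)}"

definition coeff_count :: "nat \<Rightarrow> nat \<Rightarrow> nat \<Rightarrow> nat" where
  "coeff_count k r n = card {p \<in> Av_1243_2143. length p = n \<and> inc_count k p = r}"

fun chebU :: "nat \<Rightarrow> real \<Rightarrow> real" where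
  "chebU 0 y = 1"
| "chebU (Suc 0) y = 2 * y"
| "chebU (Suc (Suc n)) y = 2 * y * chebU (Suc n) y - chebU n y"

definition index_seqs :: "nat \<Rightarrow> nat \<Rightarrow> nat \<Rightarrow> (nat list \<times> nat list) set" where
  "index_seqs k b r = {(L, M). length L = b + 1 \<and> length M = b + 1 \<and>
      r = (\<Sum>i\<le>b. (L!i + M!i) * ((k + i - 1) choose (k - 1)))}"

text \<open>l_i with the convention l_{b+1} = 0.\<close>
definition lget :: "nat list \<Rightarrow> nat \<Rightarrow> nat" where
  "lget L i = (if i < length L then L!i else 0)"

text \<open>Binomial coefficient with integer top, generalized binomial: gives C(a,0)=1 for every a.\<close>
definition binomZ :: "int \<Rightarrow> nat \<Rightarrow> real" where
  "binomZ a j = (real_of_int a) gchoose j"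

definition rhs_term :: "nat \<Rightarrow> nat \<Rightarrow> real \<Rightarrow> nat list \<times> nat list \<Rightarrow> real" where
  "rhs_term k b x LM = (case LM of (L, M) \<Rightarrow>
     let y = (1 - x) / (2 * sqrt x) in
     (\<Prod>i\<le>b. binomZ (int (L!i) + int (lget L (i+1)) + int (M!i) - 1) (lget L (i+1) + M!i)
             * binomZ (int (lget L (i+1) + M!i)) (M!i))
     * (chebU (k - 2) y powi (int (L!0) - 1)) / (chebU (k - 1) y ^ (L!0 + 1))
     * x powr ((1 - real (L!0)) / 2 + (\<Sum>j\<le>b. real (L!j + M!j))))"

end

(* If n is the maximum of a permutation p = A n B in the class and A is nonempty, avoidance forces every
   entry of A except its minimum a to exceed all of B.  So p corresponds to the pair (A, a B), and the
   increasing subsequences of length k of p are those of A, those of length k - 1 of A extended by n, and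
   those of a B.  Iterating, with q marking the increasing subsequences of length k, turns the generating
   function into a continued fraction g_j = w_j / (1 - w_j - g_(j+1)) with w_j = x q^(j choose (k - 1)).
   The first k - 1 levels do not involve q and collapse to a Moebius transformation of g_(k-1) with
   Chebyshev coefficients; the coefficient of q^r then comes from expanding the powers of g_(k-1+i) one
   level after the other by the negative binomial series.  Here l_i counts the factors g_(k-1+i) and m_i
   the summands w_(k-1+i) that are picked.  For 0 < x < 1/8 everything converges, so the q-series can be
   taken with real coefficients at a fixed x. *)

theory Submission
  imports Defs "HOL-Library.Sublist" "HOL-Analysis.Infinite_Sum" "HOL-Analysis.Elementary_Metric_Spaces"
begin

subsection \<open>Subsequences as lists\<close>

text \<open>Counts of increasing subsequences of length k are not additive over the pair (A, a B):
  those of A of length k - 1 enter too, and splitting A further brings in ever shorter ones.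
  Additivity is restored by a weight with a parameter j, the number of maxima split off so far;
  passing to A raises j by one, by Pascal's rule, while a B keeps j. This is why g_j is multiplied
  by g_(j+1) in its own equation. A single entry has weight j choose (k - 1), the exponent in w_j.
  If A is empty, p = n B is paired with the possibly empty B, which gives w_j (1 + g_j). Lengths add
  up in (A, a B) because a is used twice and n not at all. Putting a new maximum in front does not
  change the count for k >= 2, so infinitely many permutations share each attained r, and the
  coefficient of q^r is itself an infinite series in x. The bound 1/8 serves two purposes: it gives
  summability over the class, and it makes (1 - x) / (2 sqrt x) at least 1, where the Chebyshev
  values are positive and may be divided by.\<close>

lemma subseq_imp_indices:
  assumes "subseq xs ys"
  shows "\<exists>idx. sorted_wrt (<) idx \<and> (\<forall>i\<in>set idx. i < length ys) \<and> xs = map ((!) ys) idx"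
  using assms
proof (induction rule: list_emb.induct)
  case (list_emb_Nil ys)
  show ?case by (intro exI[of _ "[]"]) auto
next
  case (list_emb_Cons xs ys y)
  then obtain idx where "sorted_wrt (<) idx" "\<forall>i\<in>set idx. i < length ys" "xs = map ((!) ys) idx"
    by blast
  then show ?case by (intro exI[of _ "map Suc idx"]) (auto simp: sorted_wrt_map)
next
  case (list_emb_Cons2 x y xs ys)
  then obtain idx where "sorted_wrt (<) idx" "\<forall>i\<in>set idx. i < length ys" "xs = map ((!) ys) idx"
    by blast
  with list_emb_Cons2 show ?case
    by (intro exI[of _ "0 # map Suc idx"]) (auto simp: sorted_wrt_map)
qed

text \<open>The induction removes the last index, which bounds all earlier ones; this is why
  prefixes \<open>take n ys\<close> appear instead of \<open>ys\<close> alone.\<close>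

lemma subseq_map_nth_take:
  assumes "sorted_wrt (<) idx" "\<forall>i\<in>set idx. i < n" "n \<le> length ys"
  shows "subseq (map ((!) ys) idx) (take n ys)"
  using assms
proof (induction idx arbitrary: n rule: rev_induct)
  case Nil
  show ?case by simp
next
  case (snoc i idx)
  from snoc.prems have i: "i < n" and lt: "\<forall>j\<in>set idx. j < i" and "sorted_wrt (<) idx"
    by (auto simp: sorted_wrt_append)
  with snoc have "subseq (map ((!) ys) idx) (take i ys)" by simp
  then have "subseq (map ((!) ys) idx @ [ys ! i]) (take i ys @ [ys ! i])" by simp
  also have "take i ys @ [ys ! i] = take (Suc i) ys"
    using i snoc.prems(3) by (simp add: take_Suc_conv_app_nth)
  also have "subseq (take (Suc i) ys) (take n ys)"
    using i take_is_prefix[of "Suc i" "take n ys"] by (intro prefix_imp_subseq) (simp add: min_def)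
  finally show ?case by simp
qed

lemma subseq_iff_indices:
  "subseq xs ys \<longleftrightarrow>
     (\<exists>idx. sorted_wrt (<) idx \<and> (\<forall>i\<in>set idx. i < length ys) \<and> xs = map ((!) ys) idx)"
  using subseq_imp_indices subseq_map_nth_take[of _ "length ys" ys] by fastforce

lemma contains_pattern_iff_subseq:
  "contains_pattern s p \<longleftrightarrow>
     (\<exists>xs. subseq xs p \<and> length xs = length s \<and>
        (\<forall>a<length s. \<forall>c<length s. s ! a < s ! c \<longleftrightarrow> xs ! a < xs ! c))"
proof
  assume "contains_pattern s p"
  then obtain idx where "length idx = length s" "sorted_wrt (<) idx" "\<forall>i\<in>set idx. i < length p"
    "\<forall>a<length s. \<forall>c<length s. s ! a < s ! c \<longleftrightarrow> p ! (idx ! a) < p ! (idx ! c)"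
    unfolding contains_pattern_def by blast
  then show "\<exists>xs. subseq xs p \<and> length xs = length s \<and>
        (\<forall>a<length s. \<forall>c<length s. s ! a < s ! c \<longleftrightarrow> xs ! a < xs ! c)"
    by (intro exI[of _ "map ((!) p) idx"]) (auto simp: subseq_iff_indices)
next
  assume "\<exists>xs. subseq xs p \<and> length xs = length s \<and>
        (\<forall>a<length s. \<forall>c<length s. s ! a < s ! c \<longleftrightarrow> xs ! a < xs ! c)"
  then obtain idx where "length idx = length s" "sorted_wrt (<) idx" "\<forall>i\<in>set idx. i < length p"
    "\<forall>a<length s. \<forall>c<length s. s ! a < s ! c \<longleftrightarrow> map ((!) p) idx ! a < map ((!) p) idx ! c"
    unfolding subseq_iff_indices by auto
  then show "contains_pattern s p"
    unfolding contains_pattern_def by (intro exI[of _ idx]) auto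
qed

text \<open>For distinct entries, the order of \<open>a\<close> and \<open>b\<close> is free exactly because both \<open>1243\<close> and \<open>2143\<close>
  are forbidden.\<close>

definition good :: "nat list \<Rightarrow> bool" where
  "good p \<longleftrightarrow> (\<forall>a b c d. subseq [a, b, d, c] p \<longrightarrow> a < c \<longrightarrow> b < c \<longrightarrow> d \<le> c)"

lemma ex_list4: "(\<exists>xs. P xs \<and> length xs = 4 \<and> Q xs) \<longleftrightarrow> (\<exists>a b d c. P [a, b, d, c] \<and> Q [a, b, d, c])"
  by (auto simp: length_Suc_conv eval_nat_numeral)

lemma all_less4: "(\<forall>i<(4::nat). P i) \<longleftrightarrow> P 0 \<and> P 1 \<and> P 2 \<and> P 3"
  by (auto simp: eval_nat_numeral less_Suc_eq)

lemma contains_pattern4: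
  "contains_pattern [u, v, w, z] p \<longleftrightarrow>
     (\<exists>a b d c. subseq [a, b, d, c] p \<and>
        (\<forall>i<4. \<forall>j<4. [u, v, w, z] ! i < [u, v, w, z] ! j \<longleftrightarrow> [a, b, d, c] ! i < [a, b, d, c] ! j))"
proof -
  have len: "length [u, v, w, z] = 4" by simp
  show ?thesis unfolding contains_pattern_iff_subseq len by (rule ex_list4)
qed

lemma contains_1243:
  "contains_pattern [1,2,4,3] p \<longleftrightarrow> (\<exists>a b d c. subseq [a, b, d, c] p \<and> a < b \<and> b < c \<and> c < d)"
  unfolding contains_pattern4 all_less4 by (intro ex_cong1) auto

lemma contains_2143:
  "contains_pattern [2,1,4,3] p \<longleftrightarrow> (\<exists>a b d c. subseq [a, b, d, c] p \<and> b < a \<and> a < c \<and> c < d)"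
  unfolding contains_pattern4 all_less4 by (intro ex_cong1) auto

lemma subseq_distinct: "subseq xs ys \<Longrightarrow> distinct ys \<Longrightarrow> distinct xs"
  by (auto simp: subseq_conv_nths distinct_nthsI)

lemma Av_iff_good: "p \<in> Av_1243_2143 \<longleftrightarrow> is_perm p \<and> good p"
proof (cases "is_perm p")
  case True
  then have "distinct p" by (simp add: is_perm_def)
  then have neq: "a \<noteq> b" if "subseq [a, b, d, c] p" for a b c d
    using subseq_distinct[OF that] by simp
  have "(contains_pattern [1,2,4,3] p \<or> contains_pattern [2,1,4,3] p) \<longleftrightarrow>
      (\<exists>a b d c. subseq [a, b, d, c] p \<and> (a < b \<and> b < c \<and> c < d \<or> b < a \<and> a < c \<and> c < d))"
    unfolding contains_1243 contains_2143 by blast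
  also have "\<dots> \<longleftrightarrow> (\<exists>a b d c. subseq [a, b, d, c] p \<and> a < c \<and> b < c \<and> c < d)"
    using neq by (intro ex_cong1 conj_cong refl) (metis less_trans linorder_neqE_nat)
  also have "\<dots> \<longleftrightarrow> \<not> good p"
    unfolding good_def by (meson not_le)
  finally show ?thesis using True by (auto simp: Av_1243_2143_def)
qed (simp add: Av_1243_2143_def)

section \<open>Increasing subsequences as lists of values\<close>

definition incs :: "nat \<Rightarrow> nat list \<Rightarrow> nat list set" where
  "incs k p = {xs. subseq xs p \<and> sorted_wrt (<) xs \<and> length xs = k}"

lemma finite_incs [simp]: "finite (incs k p)"
proof -
  have "incs k p \<subseteq> set (subseqs p)" by (auto simp: incs_def)
  then show ?thesis by (rule finite_subset) simp
qed

text \<open>Because the entries are distinct, a set of positions is determined by the values found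
  there, so reading off the values in order of position is a bijection.\<close>

lemma inc_count_eq_card_incs:
  assumes "distinct p"
  shows "inc_count k p = card (incs k p)"
proof -
  let ?I = "{S. S \<subseteq> {..<length p} \<and> card S = k \<and> (\<forall>i\<in>S. \<forall>j\<in>S. i < j \<longrightarrow> p!i < p!j)}"
  let ?f = "\<lambda>S. map ((!) p) (sorted_list_of_set S)"
  have fin: "finite S" if "S \<subseteq> {..<length p}" for S :: "nat set"
    using that finite_subset by blast
  have "inj_on ?f ?I"
  proof
    fix S T assume S: "S \<in> ?I" and T: "T \<in> ?I" and eq: "?f S = ?f T"
    from S T have sub: "S \<subseteq> {..<length p}" "T \<subseteq> {..<length p}" by (simp_all only: mem_Collect_eq)
    have "inj_on ((!) p) {..<length p}"
      using assms by (simp add: inj_on_nth)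
    moreover have "(!) p ` S = (!) p ` T"
    proof -
      have "set (?f S) = set (?f T)" by (rule arg_cong[where f = set, OF eq])
      moreover have "finite S" "finite T" using sub by (auto intro: fin)
      ultimately show ?thesis by (simp only: set_map set_sorted_list_of_set)
    qed
    ultimately show "S = T" using sub by (simp only: inj_on_image_eq_iff)
  qed
  moreover have "?f ` ?I = incs k p"
  proof (intro set_eqI iffI)
    fix xs assume "xs \<in> ?f ` ?I"
    then obtain S where S: "S \<in> ?I" and xs: "xs = ?f S" by blast
    from S have sub: "S \<subseteq> {..<length p}" and card: "card S = k"
      and inc: "\<And>i j. i \<in> S \<Longrightarrow> j \<in> S \<Longrightarrow> i < j \<Longrightarrow> p ! i < p ! j" by auto
    from sub fin have fS: "finite S" by blast
    have "subseq xs p"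
      unfolding subseq_iff_indices xs
      using sub fS by (intro exI[of _ "sorted_list_of_set S"]) auto
    moreover have "sorted_wrt (\<lambda>i j. p ! i < p ! j) (sorted_list_of_set S)"
      by (rule sorted_wrt_mono_rel[OF _ strict_sorted_list_of_set]) (use inc fS in auto)
    ultimately show "xs \<in> incs k p"
      using card fS by (simp add: incs_def xs sorted_wrt_map)
  next
    fix xs assume "xs \<in> incs k p"
    then obtain idx where idx: "sorted_wrt (<) idx" "\<forall>i\<in>set idx. i < length p" "xs = map ((!) p) idx"
      and xs: "sorted_wrt (<) xs" "length xs = k"
      by (auto simp: incs_def subseq_iff_indices)
    from idx(1) have eq: "sorted_list_of_set (set idx) = idx"
      by (simp add: sorted_list_of_set.idem_if_sorted_distinct strict_sorted_iff)
    have "p ! i < p ! j" if ij: "i \<in> set idx" "j \<in> set idx" "i < j" for i j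
    proof -
      obtain a c where ac: "a < length idx" "c < length idx" "i = idx ! a" "j = idx ! c"
        using ij(1,2) by (metis in_set_conv_nth)
      have "\<not> c \<le> a"
      proof
        assume "c \<le> a"
        then have "j \<le> i"
          using sorted_wrt_nth_less[OF idx(1), of c a] ac by (cases "c = a") auto
        with ij(3) show False by simp
      qed
      then show ?thesis
        using sorted_wrt_nth_less[OF xs(1), of a c] ac idx(3) by simp
    qed
    moreover have "set idx \<subseteq> {..<length p}" using idx(2) by auto
    moreover have "card (set idx) = k"
      using idx(1,3) xs(2) by (simp add: distinct_card strict_sorted_iff)
    ultimately have "set idx \<in> ?I" by simp
    then show "xs \<in> ?f ` ?I"
      using eq idx(3) by (intro image_eqI[of _ _ "set idx"]) auto
  qed
  ultimately show ?thesis
    unfolding inc_count_def using card_image[of ?f ?I] by simp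
qed

lemma subseq_map_iff: "subseq xs (map f ys) \<longleftrightarrow> (\<exists>zs. subseq zs ys \<and> xs = map f zs)"
  by (auto simp: subseq_conv_nths nths_map)

lemma subseq_set: "subseq xs ys \<Longrightarrow> set xs \<subseteq> set ys"
  by (auto simp: subseq_conv_nths set_nths)

text \<open>Only the relative order of the entries matters, so a block of a permutation can be
  replaced by its standardization.\<close>

lemma good_map:
  fixes f :: "nat \<Rightarrow> nat"
  assumes "strict_mono_on (set p) f"
  shows "good (map f p) \<longleftrightarrow> good p"
proof -
  have less: "f x < f y \<longleftrightarrow> x < y" if "x \<in> set p" "y \<in> set p" for x y
    using assms that strict_mono_on_less by blast
  show ?thesis
  proof
    assume L: "good (map f p)"
    show "good p"
      unfolding good_def
    proof (intro allI impI)
      fix a b c d assume s: "subseq [a, b, d, c] p" and lt: "a < c" "b < c"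
      from s have "subseq [f a, f b, f d, f c] (map f p)"
        using subseq_map by force
      moreover have "a \<in> set p" "b \<in> set p" "c \<in> set p" "d \<in> set p" using subseq_set[OF s] by auto
      ultimately show "d \<le> c" using L lt less unfolding good_def by (meson not_less)
    qed
  next
    assume R: "good p"
    show "good (map f p)"
      unfolding good_def
    proof (intro allI impI)
      fix a b c d assume s: "subseq [a, b, d, c] (map f p)" and lt: "a < c" "b < c"
      then obtain zs where zs: "subseq zs p" "[a, b, d, c] = map f zs"
        by (auto simp: subseq_map_iff)
      then obtain a' b' c' d' where eq: "zs = [a', b', d', c']" "a = f a'" "b = f b'" "c = f c'" "d = f d'"
        by (auto simp: Cons_eq_map_conv)
      moreover have "a' \<in> set p" "b' \<in> set p" "c' \<in> set p" "d' \<in> set p"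
        using subseq_set[OF zs(1)] eq by auto
      ultimately show "d \<le> c" using R lt less zs(1) unfolding good_def by (metis not_less)
    qed
  qed
qed

lemma card_incs_map:
  fixes f :: "nat \<Rightarrow> nat"
  assumes "strict_mono_on (set p) f"
  shows "card (incs k (map f p)) = card (incs k p)"
proof -
  have inj: "inj_on f (set p)" using assms strict_mono_on_imp_inj_on by blast
  have srt: "sorted_wrt (<) (map f xs) \<longleftrightarrow> sorted_wrt (<) xs" if "subseq xs p" for xs
  proof -
    have "x \<in> set p" if "x \<in> set xs" for x using subseq_set[OF \<open>subseq xs p\<close>] that by auto
    then show ?thesis
      unfolding sorted_wrt_map using assms
      by (intro iffI; elim sorted_wrt_mono_rel[rotated]) (auto simp: strict_mono_on_less)
  qed
  have "incs k (map f p) = map f ` incs k p"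
    using srt by (auto simp: incs_def subseq_map_iff)
  moreover have "inj_on (map f) (incs k p)"
    by (rule inj_on_subset[OF inj_on_mapI[OF inj_on_subset[OF inj]], of "lists (set p)"])
       (auto simp: incs_def dest: subseq_set)
  ultimately show ?thesis by (simp add: card_image)
qed

subsection \<open>Splitting at the maximum\<close>

lemma good_subseq: "good p \<Longrightarrow> subseq q p \<Longrightarrow> good q"
  unfolding good_def by (meson subseq_order.order_trans)

text \<open>The first letter of a forbidden occurrence is smaller than a later one, so it is never a
  leading maximum.\<close>

lemma good_Cons_max:
  assumes "\<forall>b\<in>set B. b < n"
  shows "good (n # B) \<longleftrightarrow> good B"
proof
  assume "good (n # B)"
  then show "good B" by (rule good_subseq) auto
next
  assume B: "good B"
  show "good (n # B)"
    unfolding good_def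
  proof (intro allI impI)
    fix a b c d assume s: "subseq [a, b, d, c] (n # B)" and "a < c" "b < c"
    have "c \<in> set (n # B)" using subseq_set[OF s] by simp
    with assms \<open>a < c\<close> have "a \<noteq> n" by auto
    with s have "subseq [a, b, d, c] B" by simp
    with B \<open>a < c\<close> \<open>b < c\<close> show "d \<le> c" unfolding good_def by blast
  qed
qed

lemma incs_Cons_max:
  assumes "\<forall>b\<in>set B. b < n" "k \<ge> 2"
  shows "incs k (n # B) = incs k B"
proof -
  have "subseq xs B" if "subseq xs (n # B)" "sorted_wrt (<) xs" "length xs = k" for xs
  proof -
    from that(3) assms(2) obtain x y zs where xs: "xs = x # y # zs"
      by (metis Suc_le_length_iff numeral_2_eq_2)
    have "y \<in> set (n # B)" using subseq_set[OF that(1)] xs by simp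
    with assms(1) that(2) xs have "x \<noteq> n" by auto
    with that(1) xs show ?thesis by simp
  qed
  then show ?thesis by (auto simp: incs_def)
qed

lemma incs_1: "incs (Suc 0) p = (\<lambda>x. [x]) ` set p"
  by (auto simp: incs_def length_Suc_conv subseq_singleton_left)

lemma card_incs_1: "distinct p \<Longrightarrow> card (incs (Suc 0) p) = length p"
  unfolding incs_1 by (subst card_image) (auto simp: inj_on_def distinct_card)

text \<open>Serves both directions, gluing in \<open>glue_split_at_max\<close> and taking apart in
  \<open>AvN_cases\<close>. The entry \<open>a1\<close> is shared by the two halves
  \<open>As\<close> and \<open>a1 # B\<close>.\<close>

locale split_at_max =
  fixes As B :: "nat list" and n a1 :: nat
  assumes dist: "distinct (As @ n # B)"
    and a1: "a1 \<in> set As"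
    and As_max: "\<And>a. a \<in> set As \<Longrightarrow> a < n"
    and B_max: "\<And>b. b \<in> set B \<Longrightarrow> b < n"
    and sep: "\<And>a b. a \<in> set As \<Longrightarrow> a \<noteq> a1 \<Longrightarrow> b \<in> set B \<Longrightarrow> b < a"
begin

lemma subseq_low: "subseq (a1 # B) (As @ n # B)"
proof -
  have "subseq [a1] As" using a1 by (simp add: subseq_singleton_left)
  then have "subseq ([a1] @ B) (As @ n # B)" by (intro list_emb_append_mono) auto
  then show ?thesis by simp
qed

text \<open>In an occurrence a b d c the maximum can only be the letter d. Once c lies in
  \<open>B\<close>, a letter a or b in \<open>As\<close> is below an entry of \<open>B\<close> and
  hence equals \<open>a1\<close>; as a and b differ, at most one of them lies in \<open>As\<close>,
  and the occurrence is found in \<open>a1 # B\<close>.\<close>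

lemma good_split: "good (As @ n # B) \<longleftrightarrow> good As \<and> good (a1 # B)"
proof (intro iffI conjI)
  assume p: "good (As @ n # B)"
  show "good As" by (rule good_subseq[OF p]) auto
  show "good (a1 # B)" by (rule good_subseq[OF p subseq_low])
next
  assume g: "good As \<and> good (a1 # B)"
  show "good (As @ n # B)"
    unfolding good_def
  proof (intro allI impI, rule ccontr)
    fix a b c d assume s: "subseq [a, b, d, c] (As @ n # B)" and lt: "a < c" "b < c" and "\<not> d \<le> c"
    then have "c < d" by simp
    have "a \<noteq> b" using subseq_distinct[OF s dist] by simp
    have "d \<in> set (As @ n # B)" using subseq_set[OF s] by simp
    then have "d \<le> n" using As_max B_max by (auto intro: less_imp_le)
    with \<open>c < d\<close> lt have ne: "c \<noteq> n" "a \<noteq> n" "b \<noteq> n" by auto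
    from s obtain xs ys where eq: "[a, b, d, c] = xs @ ys" and xs: "subseq xs As" and ys: "subseq ys (n # B)"
      unfolding subseq_append_iff by blast
    have low: "u = a1" if "u \<in> set As" "c \<in> set B" "u < c" for u
      using sep[of u c] that by auto
    consider "xs = []" | "xs = [a]" | x y zs where "xs = x # y # zs"
      using eq by (cases xs rule: remdups_adj.cases) auto
    then show False
    proof cases
      case 1
      with eq ys ne have "subseq [a, b, d, c] (a1 # B)"
        by (metis append_Nil list_emb_Cons subseq_Cons2_neq)
      with g lt \<open>c < d\<close> show ?thesis unfolding good_def by (meson not_le)
    next
      case 2
      with eq ys ne have B: "subseq [b, d, c] B" by (metis append_Cons append_Nil list.inject subseq_Cons2_neq)
      then have "c \<in> set B" using subseq_set by fastforce
      moreover have "a \<in> set As" using xs 2 by (simp add: subseq_singleton_left)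
      ultimately have "a = a1" using low lt by simp
      with B have "subseq [a, b, d, c] (a1 # B)" by simp
      with g lt \<open>c < d\<close> show ?thesis unfolding good_def by (meson not_le)
    next
      case 3
      with eq have xy: "x = a" "y = b" and zs: "zs @ ys = [d, c]" by auto
      have inA: "a \<in> set As" "b \<in> set As" using subseq_set[OF xs] 3 xy by auto
      show ?thesis
      proof (cases "ys = []")
        case True
        with zs 3 xy xs have "subseq [a, b, d, c] As" by simp
        with g lt \<open>c < d\<close> show ?thesis unfolding good_def by (meson not_le)
      next
        case False
        with zs have "c \<in> set ys" by (metis last_appendR last_ConsL last_ConsR last_in_set list.distinct(1))
        with ys ne have "c \<in> set B" using subseq_set by fastforce
        with low inA lt \<open>a \<noteq> b\<close> show ?thesis by blast
      qed
    qed
  qed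
qed

text \<open>A subsequence that leaves \<open>As\<close> either stops at n or continues in
  \<open>B\<close>. In the second case its entries from \<open>As\<close> lie below an entry of
  \<open>B\<close>, so at most \<open>a1\<close> can be among them.\<close>

lemma incs_split:
  assumes "k \<ge> 2"
  shows "incs k (As @ n # B) = incs k As \<union> (\<lambda>ys. ys @ [n]) ` incs (k - 1) As \<union> incs k (a1 # B)"
proof (intro equalityI subsetI)
  fix xs assume "xs \<in> incs k (As @ n # B)"
  then have "subseq xs (As @ n # B)" and srt: "sorted_wrt (<) xs" and len: "length xs = k"
    by (auto simp: incs_def)
  then obtain ys zs where xs: "xs = ys @ zs" and ys: "subseq ys As" and zs: "subseq zs (n # B)"
    unfolding subseq_append_iff by blast
  show "xs \<in> incs k As \<union> (\<lambda>ys. ys @ [n]) ` incs (k - 1) As \<union> incs k (a1 # B)"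
  proof (cases zs)
    case Nil
    with xs ys srt len show ?thesis by (auto simp: incs_def)
  next
    case (Cons z zs')
    show ?thesis
    proof (cases "z = n")
      case True
      with zs Cons have "subseq zs' B" by simp
      then have "z' < n" if "z' \<in> set zs'" for z' using B_max subseq_set that by blast
      moreover have "n < z'" if "z' \<in> set zs'" for z'
        using srt xs Cons True that by (auto simp: sorted_wrt_append)
      ultimately have "zs' = []" by (metis last_in_set less_asym)
      with xs Cons True ys srt len have "xs = ys @ [n]" "ys \<in> incs (k - 1) As"
        by (auto simp: incs_def sorted_wrt_append)
      then show ?thesis by blast
    next
      case False
      with zs Cons have zB: "subseq zs B" by (metis subseq_Cons2_neq)
      then have "z \<in> set B" using subseq_set Cons by fastforce
      have "y = a1" if "y \<in> set ys" for y
      proof -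
        have "y < z" using srt xs Cons that by (auto simp: sorted_wrt_append)
        moreover have "y \<in> set As" using subseq_set[OF ys] that by auto
        ultimately show ?thesis using sep[of y z] \<open>z \<in> set B\<close> by auto
      qed
      moreover have "distinct ys" using subseq_distinct[OF ys] dist by simp
      ultimately have "ys = [] \<or> ys = [a1]"
        by (cases ys rule: remdups_adj.cases) auto
      with zB have "subseq xs (a1 # B)" unfolding xs by auto
      with srt len show ?thesis by (simp add: incs_def)
    qed
  qed
next
  fix xs assume "xs \<in> incs k As \<union> (\<lambda>ys. ys @ [n]) ` incs (k - 1) As \<union> incs k (a1 # B)"
  then consider "xs \<in> incs k As" | ys where "ys \<in> incs (k - 1) As" "xs = ys @ [n]" | "xs \<in> incs k (a1 # B)"
    by blast
  then show "xs \<in> incs k (As @ n # B)"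
  proof cases
    case 1
    then show ?thesis by (auto simp: incs_def)
  next
    case 2
    then have "subseq xs (As @ n # B)" by (auto simp: incs_def intro!: list_emb_append_mono)
    moreover have "y < n" if "y \<in> set ys" for y
      using 2(1) that As_max subseq_set by (fastforce simp: incs_def)
    ultimately show ?thesis using 2 assms by (auto simp: incs_def sorted_wrt_append)
  next
    case 3
    then show ?thesis using subseq_low by (auto simp: incs_def intro: subseq_order.order_trans)
  qed
qed

lemma card_incs_split:
  assumes "k \<ge> 2"
  shows "card (incs k (As @ n # B)) = card (incs k As) + card (incs (k - 1) As) + card (incs k (a1 # B))"
proof -
  have 1: "incs k As \<inter> (\<lambda>ys. ys @ [n]) ` incs (k - 1) As = {}"
  proof -
    have "n \<notin> set ys" if "ys \<in> incs k As" for ys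
      using that As_max subseq_set by (fastforce simp: incs_def)
    then show ?thesis by fastforce
  qed
  \<comment> \<open>Length at least 2 forces an entry of \<open>B\<close>, whereas the list
    \<open>[a1]\<close> alone would belong to both halves.\<close>
  have 2: "(incs k As \<union> (\<lambda>ys. ys @ [n]) ` incs (k - 1) As) \<inter> incs k (a1 # B) = {}"
  proof -
    have "\<exists>e\<in>set xs. e \<in> set B" if "xs \<in> incs k (a1 # B)" for xs
    proof -
      from that have sub: "subseq xs (a1 # B)" and srt: "sorted_wrt (<) xs" and "length xs = k"
        by (auto simp: incs_def)
      with assms obtain x y zs where xs: "xs = x # y # zs"
        by (metis Suc_le_length_iff numeral_2_eq_2)
      with srt have "x \<noteq> y" by auto
      with subseq_set[OF sub] xs show ?thesis by auto
    qed
    moreover have "set xs \<subseteq> insert n (set As)"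
      if "xs \<in> incs k As \<union> (\<lambda>ys. ys @ [n]) ` incs (k - 1) As" for xs
      using that subseq_set by (fastforce simp: incs_def)
    ultimately show ?thesis using dist by fastforce
  qed
  have "card ((\<lambda>ys. ys @ [n]) ` incs (k - 1) As) = card (incs (k - 1) As)"
    by (rule card_image) (auto simp: inj_on_def)
  then show ?thesis
    unfolding incs_split[OF assms] using 1 2 by (simp add: card_Un_disjoint)
qed

end

section \<open>Assembling and decomposing the nonempty permutations of the class\<close>

definition AvN :: "nat list set" where
  "AvN = {p. is_perm p \<and> good p \<and> p \<noteq> []}"

text \<open>The relabelling of A inside the glued permutation: the minimum 1 becomes the shared
  entry, and all other values move above the values 1, ..., \<open>length C\<close> of
  \<open>C\<close>.\<close>

definition spread :: "nat list \<Rightarrow> nat \<Rightarrow> nat" where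
  "spread C v = (if v = 1 then hd C else v + (length C - 1))"

text \<open>The head of \<open>C\<close> is dropped because \<open>spread C\<close> has already
  placed it in the left block; the new maximum makes up for it, so lengths add.\<close>

definition glue :: "nat list \<times> nat list \<Rightarrow> nat list" where
  "glue = (\<lambda>(A, C). map (spread C) A @ (length A + length C) # tl C)"

definition push_max :: "nat list \<Rightarrow> nat list" where
  "push_max B = Suc (length B) # B"

lemma perm_set: "is_perm p \<Longrightarrow> set p = {1..length p}" "is_perm p \<Longrightarrow> distinct p"
  by (auto simp: is_perm_def)

lemma is_permI:
  assumes "distinct p" "set p \<subseteq> {1..length p}"
  shows "is_perm p"
  unfolding is_perm_def using assms by (simp add: card_subset_eq distinct_card)

lemma AvN_hd_tl:
  assumes "C \<in> AvN"
  shows "set (tl C) = {1..length C} - {hd C}" "distinct (tl C)" "1 \<le> hd C" "hd C \<le> length C"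
    "hd C # tl C = C" "length (tl C) = length C - 1" "length C > 0"
proof -
  obtain c B where C: "C = c # B" using assms by (cases C) (auto simp: AvN_def)
  have p: "set C = {1..length C}" "distinct C" using assms by (auto simp: AvN_def perm_set)
  have "hd C \<in> set C" using C by simp
  then have "hd C \<in> {1..length C}" by (simp only: p(1))
  then show "1 \<le> hd C" "hd C \<le> length C" by simp_all
  have "set (tl C) = set C - {hd C}" using p(2) C by auto
  then show "set (tl C) = {1..length C} - {hd C}" by (simp only: p(1))
  show "distinct (tl C)" using p(2) by (rule distinct_tl)
  show "hd C # tl C = C" "length C > 0" using C by simp_all
qed simp

lemma spread_strict_mono:
  assumes "C \<in> AvN"
  shows "strict_mono_on {1..} (spread C)"
  using AvN_hd_tl(3,4)[OF assms] by (auto simp: strict_mono_on_def spread_def)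

lemma spread_image:
  assumes A: "is_perm A" "A \<noteq> []" and C: "C \<noteq> []"
  shows "spread C ` set A = insert (hd C) {Suc (length C)..<length A + length C}"
proof -
  have "Suc 0 \<le> length A" using A by (simp add: Suc_le_eq)
  then have "set A = insert 1 {2..<Suc (length A)}"
    unfolding perm_set(1)[OF A(1)] by auto
  then have "spread C ` set A = insert (spread C 1) (spread C ` {2..<Suc (length A)})"
    by (simp only: image_insert)
  also have "spread C ` {2..<Suc (length A)} = (\<lambda>v. v + (length C - 1)) ` {2..<Suc (length A)}"
    by (rule image_cong) (auto simp: spread_def)
  also have "\<dots> = {2 + (length C - 1)..<Suc (length A) + (length C - 1)}"
    by (rule image_add_atLeastLessThan')
  also have "\<dots> = {Suc (length C)..<length A + length C}"
    using C by (cases C) auto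
  finally show ?thesis by (simp add: spread_def)
qed

lemma spread_strict_mono_perm:
  assumes "C \<in> AvN" "is_perm A"
  shows "strict_mono_on (set A) (spread C)"
  by (rule monotone_on_subset[OF spread_strict_mono[OF assms(1)]])
     (simp add: perm_set(1)[OF assms(2)] atLeastAtMost_def)

lemma glue_split_at_max:
  assumes A: "A \<in> AvN" and C: "C \<in> AvN"
  shows "split_at_max (map (spread C) A) (tl C) (length A + length C) (hd C)"
proof -
  have pA: "is_perm A" "A \<noteq> []" using A by (auto simp: AvN_def)
  then have len: "Suc 0 \<le> length A" by (simp add: Suc_le_eq)
  note C' = AvN_hd_tl[OF C]
  have img: "spread C ` set A = insert (hd C) {Suc (length C)..<length A + length C}"
    by (rule spread_image[OF pA]) (use C in \<open>simp add: AvN_def\<close>)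
  have "inj_on (spread C) (set A)"
    by (rule strict_mono_on_imp_inj_on[OF spread_strict_mono_perm[OF C pA(1)]])
  then have dA: "distinct (map (spread C) A)"
    using perm_set(2)[OF pA(1)] by (simp add: distinct_map)
  show ?thesis
  proof
    show "distinct (map (spread C) A @ (length A + length C) # tl C)"
      unfolding distinct_append using dA C'(2-4) len by (auto simp: img C'(1))
    show "hd C \<in> set (map (spread C) A)"
      by (simp add: img)
  next
    fix a assume "a \<in> set (map (spread C) A)"
    then show "a < length A + length C" using C'(4) len by (auto simp: img)
  next
    fix b assume "b \<in> set (tl C)"
    then show "b < length A + length C" using len by (auto simp: C'(1))
  next
    fix a b assume "a \<in> set (map (spread C) A)" "a \<noteq> hd C" "b \<in> set (tl C)"
    then show "b < a" by (auto simp: img C'(1))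
  qed
qed

lemma glue_props:
  assumes A: "A \<in> AvN" and C: "C \<in> AvN"
  shows "glue (A, C) \<in> AvN"
    and "length (glue (A, C)) = length A + length C"
    and "k \<ge> 2 \<Longrightarrow> card (incs k (glue (A, C))) =
      card (incs k A) + card (incs (k - 1) A) + card (incs k C)"
proof -
  interpret split_at_max "map (spread C) A" "tl C" "length A + length C" "hd C"
    by (rule glue_split_at_max[OF assms])
  have pA: "is_perm A" "A \<noteq> []" "good A" and gC: "good C" using A C by (auto simp: AvN_def)
  note C' = AvN_hd_tl[OF C]
  note mono = spread_strict_mono_perm[OF C pA(1)]
  show len: "length (glue (A, C)) = length A + length C"
    using C'(7) by (simp add: glue_def)
  have "is_perm (glue (A, C))"
  proof (rule is_permI)
    show "distinct (glue (A, C))" using dist by (simp add: glue_def)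
    have "spread C ` set A = insert (hd C) {Suc (length C)..<length A + length C}"
      by (rule spread_image[OF pA(1,2)]) (use C in \<open>simp add: AvN_def\<close>)
    then show "set (glue (A, C)) \<subseteq> {1..length (glue (A, C))}"
      unfolding len using C'(3,4,7) by (auto simp: glue_def C'(1))
  qed
  moreover have "good (glue (A, C))"
    using good_split good_map[OF mono] pA gC by (simp add: glue_def C'(5))
  moreover have "glue (A, C) \<noteq> []" by (simp add: glue_def)
  ultimately show "glue (A, C) \<in> AvN" by (simp add: AvN_def)
  show "card (incs k (glue (A, C))) = card (incs k A) + card (incs (k - 1) A) + card (incs k C)"
    if "k \<ge> 2"
    using card_incs_split[OF that] by (simp add: glue_def C'(5) card_incs_map[OF mono])
qed

lemma push_max_props:
  assumes "is_perm B" "good B"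
  shows "push_max B \<in> AvN" "length (push_max B) = Suc (length B)"
    "k \<ge> 2 \<Longrightarrow> card (incs k (push_max B)) = card (incs k B)"
proof -
  have B: "distinct B" "set B = {1..length B}" using assms(1) by (simp_all add: perm_set)
  then have lt: "\<forall>b\<in>set B. b < Suc (length B)" by auto
  have "is_perm (push_max B)"
    by (rule is_permI) (use B lt in \<open>auto simp: push_max_def\<close>)
  then show "push_max B \<in> AvN"
    using assms(2) good_Cons_max[OF lt] by (simp add: AvN_def push_max_def)
  show "k \<ge> 2 \<Longrightarrow> card (incs k (push_max B)) = card (incs k B)"
    by (simp only: push_max_def incs_Cons_max[OF lt])
qed (simp add: push_max_def)

lemma inj_push_max: "inj push_max"
  by (auto simp: inj_def push_max_def)

lemma append_Cons_eq_append_Cons: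
  assumes "xs @ n # ys = xs' @ n # ys'" "n \<notin> set xs" "n \<notin> set xs'"
  shows "xs = xs' \<and> ys = ys'"
  using assms by (induction xs xs' rule: list_induct2') auto

text \<open>The maximum equals the total length and marks the cut. The right block gives the tail of
  \<open>C\<close>, the minimum of the left block gives its head, and then \<open>spread C\<close>
  can be undone.\<close>

lemma inj_glue: "inj_on glue (AvN \<times> AvN)"
proof (intro inj_onI, clarify)
  fix A C A' C' assume AC: "A \<in> AvN" "C \<in> AvN" "A' \<in> AvN" "C' \<in> AvN" and eq: "glue (A, C) = glue (A', C')"
  interpret s: split_at_max "map (spread C) A" "tl C" "length A + length C" "hd C"
    using AC by (intro glue_split_at_max)
  interpret s': split_at_max "map (spread C') A'" "tl C'" "length A' + length C'" "hd C'"
    using AC by (intro glue_split_at_max)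
  have n: "length A + length C = length A' + length C'"
    using glue_props(2) AC eq by metis
  have *: "map (spread C) A = map (spread C') A' \<and> tl C = tl C'"
  proof (rule append_Cons_eq_append_Cons)
    show "map (spread C) A @ (length A + length C) # tl C = map (spread C') A' @ (length A + length C) # tl C'"
      using eq by (simp only: glue_def prod.case n)
    show "length A + length C \<notin> set (map (spread C) A)" using s.As_max by blast
    show "length A + length C \<notin> set (map (spread C') A')" unfolding n using s'.As_max by blast
  qed
  have min: "Min (set (map (spread E) D)) = hd E" if D: "D \<in> AvN" and E: "E \<in> AvN" for D E
  proof -
    have "spread E ` set D = insert (hd E) {Suc (length E)..<length D + length E}"
      by (rule spread_image) (use D E in \<open>simp_all add: AvN_def\<close>)
    then show ?thesis
      using AvN_hd_tl(4)[OF E] by (intro Min_eqI) auto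
  qed
  have "hd C = hd C'" using min[OF AC(1,2)] min[OF AC(3,4)] * by metis
  moreover have "C \<noteq> []" "C' \<noteq> []" using AC by (auto simp: AvN_def)
  ultimately have C: "C = C'" using * by (metis list.expand)
  have "inj_on (spread C) (set A \<union> set A')"
  proof (rule inj_on_subset[OF strict_mono_on_imp_inj_on[OF spread_strict_mono[OF AC(2)]]])
    have "set A = {1..length A}" "set A' = {1..length A'}"
      using AC by (simp_all add: AvN_def perm_set(1))
    then show "set A \<union> set A' \<subseteq> {1..}" by auto
  qed
  with * C have "A = A'" by (simp add: inj_on_map_eq_map)
  with C show "A = A' \<and> C = C'" by simp
qed

lemma downset_eq_atLeastAtMost:
  fixes X :: "nat set"
  assumes "finite X" "0 \<notin> X" "\<And>v w. v \<in> X \<Longrightarrow> 0 < w \<Longrightarrow> w < v \<Longrightarrow> w \<in> X"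
  shows "X = {1..card X}"
proof (cases "X = {}")
  case False
  then have "X = {1..Max X}"
  proof (intro equalityI subsetI)
    fix v assume "v \<in> X"
    then show "v \<in> {1..Max X}" using assms(1,2) by (cases v) auto
  next
    fix v assume "v \<in> {1..Max X}"
    moreover have "Max X \<in> X" using False assms(1) by simp
    ultimately show "v \<in> X" using assms(3)[of "Max X" v] by (cases "v = Max X") auto
  qed
  then show ?thesis by (metis card_atLeastAtMost diff_Suc_1)
qed simp

lemma subseq_pair:
  assumes "u \<in> set xs" "v \<in> set xs" "u \<noteq> v"
  shows "subseq [u, v] xs \<or> subseq [v, u] xs"
  using assms by (induction xs) (auto simp: subseq_singleton_left)

text \<open>The surjectivity half of the bijection: \<open>push_max\<close> covers the permutations
  that begin with their maximum, \<open>glue\<close> all others.\<close>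

lemma AvN_cases:
  assumes "p \<in> AvN"
  obtains B where "is_perm B" "good B" "p = push_max B"
    | A C where "A \<in> AvN" "C \<in> AvN" "p = glue (A, C)"
proof -
  define n where "n = length p"
  have p: "is_perm p" "good p" "p \<noteq> []" using assms by (auto simp: AvN_def)
  then have "n \<in> set p" by (simp add: perm_set n_def Suc_le_eq)
  then obtain As B where split: "p = As @ n # B" by (meson split_list)
  have setp: "set p = {1..n}" "distinct p" using p by (simp_all add: perm_set n_def)
  have n: "n = length As + Suc (length B)"
    using arg_cong[where f = length, OF split] by (simp only: n_def[symmetric] length_append list.size)
  have B_lt: "b < n" if "b \<in> set B" for b
    using setp split that by (auto simp: le_less)
  have As_lt: "b < n" if "b \<in> set As" for b
    using setp split that by (auto simp: le_less)
  show ?thesis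
  proof (cases "As = []")
    case True
    have "is_perm B"
    proof (rule is_permI)
      show "set B \<subseteq> {1..length B}"
        using setp(1) B_lt n unfolding split True by fastforce
    qed (use setp split in auto)
    moreover have "good B" using p(2) by (rule good_subseq) (auto simp: split)
    ultimately show ?thesis using that(1)[of B] split True n by (simp add: push_max_def)
  next
    case False
    define a1 where "a1 = Min (set As)"
    have a1: "a1 \<in> set As" using False by (simp add: a1_def)
    have a1_le: "a1 \<le> a" if "a \<in> set As" for a using that by (simp add: a1_def)
    \<comment> \<open>If a and the minimum \<open>a1\<close> were both below b, then in whichever
      order they come they would form a forbidden pattern together with n and b.\<close>
    have sep: "b < a" if "a \<in> set As" "a \<noteq> a1" "b \<in> set B" for a b
    proof (rule ccontr)
      assume "\<not> b < a"
      moreover have "a \<noteq> b" using setp that split by auto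
      ultimately have "a < b" by simp
      with a1_le[OF that(1)] have "a1 < b" by simp
      have "subseq [n, b] (n # B)" using that(3) by (simp add: subseq_singleton_left)
      moreover have "subseq [a1, a] As \<or> subseq [a, a1] As" using a1 that by (intro subseq_pair) auto
      ultimately have "subseq ([a1, a] @ [n, b]) p \<or> subseq ([a, a1] @ [n, b]) p"
        unfolding split using list_emb_append_mono by blast
      then have "n \<le> b"
        using p(2) \<open>a < b\<close> \<open>a1 < b\<close> unfolding good_def by auto
      with B_lt[OF that(3)] show False by simp
    qed
    interpret split_at_max As B n a1
      by standard (use setp split a1 As_lt B_lt sep in auto)
    define C where "C = a1 # B"
    define m where "m = length B"
    have distC: "distinct C" using dist a1 by (auto simp: C_def)
    then have card: "card (set C) = Suc m" by (simp add: distinct_card C_def m_def)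
    \<comment> \<open>Entries of \<open>As\<close> other than \<open>a1\<close> exceed all of
      \<open>C\<close>, so \<open>C\<close> consists of the smallest values and is already a
      permutation without relabelling.\<close>
    have setC: "set C = {1..Suc m}"
      unfolding card[symmetric]
    proof (rule downset_eq_atLeastAtMost)
      show "0 \<notin> set C" using setp split a1 by (auto simp: C_def)
      fix v w assume v: "v \<in> set C" and w: "0 < w" "w < v"
      have "v < n" using v a1 As_lt B_lt by (auto simp: C_def)
      with w have "w \<in> set p" "w \<noteq> n" by (auto simp: setp)
      then have "w \<in> set As \<or> w \<in> set B" by (simp add: split)
      moreover have "w = a1" if "w \<in> set As"
        using v w sep[OF that] a1_le[OF that] by (fastforce simp: C_def)
      ultimately show "w \<in> set C" by (auto simp: C_def)
    qed simp
    have permC: "is_perm C"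
      using distC setC by (simp add: is_perm_def C_def m_def)
    have gAC: "good As" "good C"
      using p(2) good_split by (simp_all add: split C_def)
    with permC have C: "C \<in> AvN" by (simp add: AvN_def C_def)
    \<comment> \<open>The inverse of \<open>spread C\<close> on the entries of \<open>As\<close>;
      the shift is \<open>m\<close>, which is \<open>length C - 1\<close>.\<close>
    define g where "g v = (if v = a1 then 1 else v - m)" for v
    have big: "Suc m < v" if "v \<in> set As" "v \<noteq> a1" for v
    proof (rule ccontr)
      assume "\<not> Suc m < v"
      moreover have "0 < v" using that setp split by auto
      ultimately have "v \<in> set C" by (auto simp: setC)
      with that dist show False by (auto simp: C_def)
    qed
    have spread_g: "spread C (g v) = v" if "v \<in> set As" for v
      using big[OF that] by (auto simp: spread_def g_def C_def m_def)
    define A where "A = map g As"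
    have As_eq: "map (spread C) A = As"
      using spread_g by (simp add: A_def map_idI)
    have permA: "is_perm A"
    proof (rule is_permI)
      have "distinct (map (spread C) A)" using dist As_eq by simp
      then show "distinct A" by (simp add: distinct_map)
      show "set A \<subseteq> {1..length A}"
      proof
        fix u assume "u \<in> set A"
        then obtain v where v: "v \<in> set As" "u = g v" by (auto simp: A_def)
        have "Suc 0 \<le> length As" using False by (simp add: Suc_le_eq)
        moreover have "v < n" using As_lt v by simp
        ultimately show "u \<in> {1..length A}"
          using v(2) big[OF v(1)] n by (auto simp: g_def m_def A_def)
      qed
    qed
    have "strict_mono_on (set A) (spread C)"
      by (rule spread_strict_mono_perm[OF C permA])
    with gAC(1) have "good A" using good_map As_eq by metis
    with permA False have A: "A \<in> AvN" by (simp add: AvN_def A_def)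
    have "p = glue (A, C)"
      using As_eq split n by (simp add: glue_def C_def A_def)
    with A C show ?thesis by (rule that(2))
  qed
qed

text \<open>In a glued permutation a nonempty block precedes the maximum.\<close>

lemma push_max_neq_glue:
  assumes "A \<in> AvN" "C \<in> AvN" "is_perm B"
  shows "push_max B \<noteq> glue (A, C)"
proof
  assume eq: "push_max B = glue (A, C)"
  interpret split_at_max "map (spread C) A" "tl C" "length A + length C" "hd C"
    by (rule glue_split_at_max[OF assms(1,2)])
  obtain a A' where A: "A = a # A'" using assms(1) by (cases A) (auto simp: AvN_def)
  have "Suc (length B) = length A + length C"
    using glue_props(2)[OF assms(1,2)] eq by (metis length_Cons push_max_def)
  moreover have "spread C a < length A + length C" using As_max A by simp
  ultimately show False using eq A by (simp add: push_max_def glue_def)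
qed

text \<open>\<open>wt k j p\<close> counts the increasing subsequences of length \<open>k\<close> of \<open>1\<dots>j \<oplus> p\<close> that meet \<open>p\<close>; the shift in \<open>j\<close>
  accounts for the \<open>j\<close> maxima that have been split off to the right of a factor.\<close>

definition wt :: "nat \<Rightarrow> nat \<Rightarrow> nat list \<Rightarrow> nat" where
  "wt k j p = (\<Sum>m=1..k. (j choose (k - m)) * card (incs m p))"

text \<open>The additional subsequences of A, of length m - 1, shift the lower index of the binomial
  by one, and Pascal's rule merges them into the weight with \<open>Suc j\<close>. The term m = 1 is
  treated apart: there the counts are lengths, which simply add.\<close>

lemma wt_glue:
  assumes A: "A \<in> AvN" and C: "C \<in> AvN" and k: "k \<ge> 1"
  shows "wt k j (glue (A, C)) = wt k (Suc j) A + wt k j C"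
proof -
  let ?t = "\<lambda>m p. card (incs m p)"
  have d: "distinct A" "distinct C" "distinct (glue (A, C))"
    using A C glue_props(1)[OF A C] by (auto simp: AvN_def perm_set)
  have 1: "?t (Suc 0) (glue (A, C)) = ?t (Suc 0) A + ?t (Suc 0) C"
    using d glue_props(2)[OF A C] by (simp add: card_incs_1)
  obtain k' where k': "k = Suc k'" using k by (cases k) auto
  have shift: "(\<Sum>m=2..k. (j choose (k - m)) * ?t (m - 1) A) = (\<Sum>m=1..k'. (j choose (k' - m)) * ?t m A)"
    unfolding k' by (rule sum.reindex_bij_witness[of _ Suc "\<lambda>m. m - 1"]) auto
  have split: "sum f {1..k} = f 1 + sum f {2..k}" for f :: "nat \<Rightarrow> nat"
    using k by (simp add: sum.atLeast_Suc_atMost numeral_2_eq_2)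
  have "wt k j (glue (A, C)) = (j choose (k - 1)) * (?t 1 A + ?t 1 C) +
      (\<Sum>m=2..k. (j choose (k - m)) * (?t m A + ?t (m - 1) A + ?t m C))"
    unfolding wt_def split using 1 glue_props(3)[OF A C] by simp
  also have "\<dots> = wt k j A + wt k j C + (\<Sum>m=2..k. (j choose (k - m)) * ?t (m - 1) A)"
    unfolding wt_def split by (simp add: algebra_simps sum.distrib)
  moreover have "wt k j A + (\<Sum>m=2..k. (j choose (k - m)) * ?t (m - 1) A) = wt k (Suc j) A"
  proof -
    have "wt k j A + (\<Sum>m=1..k'. (j choose (k' - m)) * ?t m A)
        = (\<Sum>m=1..k'. ((j choose (Suc k' - m)) + (j choose (k' - m))) * ?t m A) + ?t k A"
      by (simp add: wt_def k' algebra_simps sum.distrib)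
    also have "(\<Sum>m=1..k'. ((j choose (Suc k' - m)) + (j choose (k' - m))) * ?t m A)
        = (\<Sum>m=1..k'. (Suc j choose (Suc k' - m)) * ?t m A)"
      by (rule sum.cong) (auto simp: Suc_diff_le)
    also have "\<dots> + ?t k A = wt k (Suc j) A" by (simp add: wt_def k')
    finally show ?thesis by (simp only: shift)
  qed
  ultimately show ?thesis by simp
qed

text \<open>A leading maximum occurs only in an increasing subsequence of length 1, and these carry
  the factor \<open>j choose (k - 1)\<close>.\<close>

lemma wt_push_max:
  assumes "is_perm B" "good B" "k \<ge> 1"
  shows "wt k j (push_max B) = (j choose (k - 1)) + wt k j B"
proof -
  have split: "sum f {1..k} = f 1 + sum f {2..k}" for f :: "nat \<Rightarrow> nat"
    using assms(3) by (simp add: sum.atLeast_Suc_atMost numeral_2_eq_2)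
  have "distinct B" "distinct (push_max B)"
    using assms push_max_props(1)[OF assms(1,2)] by (auto simp: AvN_def perm_set)
  then show ?thesis
    unfolding wt_def split using push_max_props(2,3)[OF assms(1,2)]
    by (simp add: card_incs_1)
qed

lemma wt_Nil: "wt k j [] = 0"
proof -
  have "incs m [] = {}" if "m \<ge> 1" for m using that by (auto simp: incs_def dest: list_emb_length)
  then show ?thesis by (simp add: wt_def)
qed

lemma wt_0:
  assumes "k \<ge> 1"
  shows "wt k 0 p = card (incs k p)"
proof -
  have "wt k 0 p = (\<Sum>m=1..k. if m = k then card (incs m p) else 0)"
    unfolding wt_def by (rule sum.cong) (auto simp: binomial_eq_0)
  also have "\<dots> = card (incs k p)" using assms by simp
  finally show ?thesis .
qed

text \<open>The term m = 1 alone suffices, as a nonempty permutation has a subsequence of length 1.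
  The bound makes the series of level j start no earlier than at q to the power
  \<open>j choose (k - 1)\<close>, on which the truncation of the continued fraction rests.\<close>

lemma wt_ge:
  assumes "p \<in> AvN" "k \<ge> 1"
  shows "j choose (k - 1) \<le> wt k j p"
proof -
  have "card (incs 1 p) \<ge> 1"
    using assms card_incs_1[of p] by (simp add: AvN_def perm_set(2) Suc_le_eq)
  then have "j choose (k - 1) \<le> (j choose (k - 1)) * card (incs 1 p)" by simp
  also have "\<dots> \<le> wt k j p"
    unfolding wt_def using assms(2) by (intro member_le_sum) auto
  finally show ?thesis .
qed

subsection \<open>Weighted sums over the class\<close>

lemma finite_perms: "finite {p. is_perm p \<and> length p = n}"
proof -
  have "{p. is_perm p \<and> length p = n} \<subseteq> {p. set p \<subseteq> {1..n} \<and> length p = n}"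
    by (auto simp: is_perm_def)
  then show ?thesis by (rule finite_subset) (simp add: finite_lists_length_eq)
qed

lemma finite_AvN_le: "finite {p \<in> AvN. length p \<le> m}"
proof -
  have "{p \<in> AvN. length p \<le> m} \<subseteq> (\<Union>n\<le>m. {p. is_perm p \<and> length p = n})"
    by (auto simp: AvN_def)
  then show ?thesis by (rule finite_subset) (use finite_perms in blast)
qed

text \<open>If s is the sum up to length m, the decomposition bounds the sum up to length m + 1 by x
  (1 + s) + s^2, because both halves of a glued permutation are shorter than the whole. The bound
  1/4 reproduces itself: 1/8 * 5/4 + 1/16 = 7/32.\<close>

lemma AvN_partial_sum_le:
  fixes x :: real
  assumes x: "0 < x" "x \<le> 1/8"
  shows "(\<Sum>p | p \<in> AvN \<and> length p \<le> m. x ^ length p) \<le> 1/4"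
proof (induction m)
  case 0
  have "{p. p \<in> AvN \<and> length p \<le> 0} = {}" by (auto simp: AvN_def)
  then show ?case by (simp only: sum.empty)
next
  case (Suc m)
  let ?S = "\<lambda>m. {p. p \<in> AvN \<and> length p \<le> m}"
  define s where "s = (\<Sum>p\<in>?S m. x ^ length p)"
  have fin: "finite (?S m)" for m using finite_AvN_le by simp
  have s: "0 \<le> s" "s \<le> 1/4" using Suc x by (auto simp: s_def intro!: sum_nonneg)
  have sub: "?S (Suc m) \<subseteq> push_max ` insert [] (?S m) \<union> glue ` (?S m \<times> ?S m)"
  proof
    fix p assume p: "p \<in> ?S (Suc m)"
    then have "p \<in> AvN" by simp
    then show "p \<in> push_max ` insert [] (?S m) \<union> glue ` (?S m \<times> ?S m)"
    proof (cases rule: AvN_cases)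
      case (1 B)
      then have "B \<in> insert [] (?S m)" using p by (auto simp: AvN_def push_max_def)
      then show ?thesis using 1(3) by blast
    next
      case (2 A C)
      have "Suc 0 \<le> length A" "Suc 0 \<le> length C" using 2 by (simp_all add: AvN_def Suc_le_eq)
      then have "(A, C) \<in> ?S m \<times> ?S m" using 2 p glue_props(2)[OF 2(1,2)] by auto
      then show ?thesis using 2(3) by blast
    qed
  qed
  have 1: "(\<Sum>p\<in>push_max ` insert [] (?S m). x ^ length p) = x * (1 + s)"
  proof -
    have "(\<Sum>p\<in>push_max ` insert [] (?S m). x ^ length p) = (\<Sum>B\<in>insert [] (?S m). x ^ Suc (length B))"
      by (subst sum.reindex) (auto intro: inj_on_subset[OF inj_push_max] simp: push_max_def)
    also have "\<dots> = x * (1 + s)"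
      using fin by (subst sum.insert) (auto simp: AvN_def s_def sum_distrib_left algebra_simps)
    finally show ?thesis .
  qed
  have 2: "(\<Sum>p\<in>glue ` (?S m \<times> ?S m). x ^ length p) = s * s"
  proof -
    have "inj_on glue (?S m \<times> ?S m)" by (rule inj_on_subset[OF inj_glue]) auto
    then have "(\<Sum>p\<in>glue ` (?S m \<times> ?S m). x ^ length p) = (\<Sum>q\<in>?S m \<times> ?S m. x ^ length (glue q))"
      by (simp add: sum.reindex)
    also have "\<dots> = (\<Sum>(A, C)\<in>?S m \<times> ?S m. x ^ length A * x ^ length C)"
      by (rule sum.cong) (auto simp: glue_props(2) power_add)
    also have "\<dots> = s * s"
      unfolding s_def sum_product sum.cartesian_product ..
    finally show ?thesis .
  qed
  have "(\<Sum>p\<in>?S (Suc m). x ^ length p)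
      \<le> (\<Sum>p\<in>push_max ` insert [] (?S m) \<union> glue ` (?S m \<times> ?S m). x ^ length p)"
    using sub fin x by (intro sum_mono2) auto
  also have "\<dots> \<le> x * (1 + s) + s * s"
  proof -
    have "(\<Sum>p\<in>P \<union> Q. x ^ length p) \<le> (\<Sum>p\<in>P. x ^ length p) + (\<Sum>p\<in>Q. x ^ length p)"
      if "finite P" "finite Q" for P Q :: "nat list set"
      using that x sum.union_inter[OF that, of "\<lambda>p. x ^ length p"]
        sum_nonneg[of "P \<inter> Q" "\<lambda>p. x ^ length p"] by simp
    from this[of "push_max ` insert [] (?S m)" "glue ` (?S m \<times> ?S m)"] fin
    show ?thesis unfolding 1 2 by blast
  qed
  also have "\<dots> \<le> 1/8 * (1 + 1/4) + 1/4 * (1/4)"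
    using s x by (intro add_mono mult_mono) auto
  finally show ?case by simp
qed

lemma AvN_summable:
  fixes x :: real
  assumes "0 < x" "x \<le> 1/8"
  shows "(\<lambda>p. x ^ length p) summable_on AvN"
proof (rule nonneg_bdd_above_summable_on)
  show "bdd_above (sum (\<lambda>p. x ^ length p) ` {F. F \<subseteq> AvN \<and> finite F})"
  proof (rule bdd_aboveI2[where M = "1/4"])
    fix F assume F: "F \<in> {F. F \<subseteq> AvN \<and> finite F}"
    define m where "m = Max (insert 0 (length ` F))"
    have "F \<subseteq> {p. p \<in> AvN \<and> length p \<le> m}" using F by (auto simp: m_def)
    then have "sum (\<lambda>p. x ^ length p) F \<le> (\<Sum>p | p \<in> AvN \<and> length p \<le> m. x ^ length p)"
      using assms finite_AvN_le by (intro sum_mono2) auto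
    also have "\<dots> \<le> 1/4" by (rule AvN_partial_sum_le[OF assms])
    finally show "sum (\<lambda>p. x ^ length p) F \<le> 1/4" .
  qed
qed (use assms in simp)

definition wt_class :: "nat \<Rightarrow> nat \<Rightarrow> nat \<Rightarrow> nat list set" where
  "wt_class k j r = {p \<in> AvN. wt k j p = r}"

text \<open>The variable \<open>fps_X\<close> plays the role of q, while \<open>x\<close> is a fixed
  real number.\<close>

definition gf :: "nat \<Rightarrow> real \<Rightarrow> nat \<Rightarrow> real fps" where
  "gf k x j = Abs_fps (\<lambda>r. \<Sum>\<^sub>\<infinity>p\<in>wt_class k j r. x ^ length p)"

context
  fixes x :: real and k :: nat
  assumes x: "0 < x" "x \<le> 1/8" and k: "k \<ge> 1"
begin

lemma gf_has_sum: "((\<lambda>p. x ^ length p) has_sum fps_nth (gf k x j) r) (wt_class k j r)"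
proof -
  have "(\<lambda>p. x ^ length p) summable_on wt_class k j r"
    by (rule summable_on_subset_banach[OF AvN_summable[OF x]]) (auto simp: wt_class_def)
  then show ?thesis by (simp add: gf_def)
qed

text \<open>The empty list is listed separately because \<open>push_max\<close> accepts it, while
  \<open>wt_class\<close> contains nonempty permutations only.\<close>

lemma wt_class_decomp:
  "wt_class k j r =
     push_max ` ((if r = j choose (k - 1) then {[]} else {}) \<union>
       (if j choose (k - 1) \<le> r then wt_class k j (r - (j choose (k - 1))) else {})) \<union>
     glue ` (\<Union>s\<in>{..r}. wt_class k (Suc j) s \<times> wt_class k j (r - s))"
  (is "_ = push_max ` ?P \<union> glue ` ?Q")
proof (intro equalityI subsetI)
  fix p assume "p \<in> wt_class k j r"
  then have p: "p \<in> AvN" "wt k j p = r" by (auto simp: wt_class_def)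
  from p(1) show "p \<in> push_max ` ?P \<union> glue ` ?Q"
  proof (cases rule: AvN_cases)
    case (1 B)
    have "r = (j choose (k - 1)) + wt k j B" using wt_push_max[OF 1(1,2) k] p 1 by simp
    then have "B \<in> ?P" using 1 by (cases "B = []") (auto simp: wt_Nil wt_class_def AvN_def)
    then show ?thesis using 1 by blast
  next
    case (2 A C)
    have "r = wt k (Suc j) A + wt k j C" using wt_glue[OF 2(1,2) k] p 2 by simp
    then have "(A, C) \<in> ?Q" using 2 by (auto simp: wt_class_def intro!: bexI[of _ "wt k (Suc j) A"])
    then show ?thesis using 2 by blast
  qed
next
  fix p assume "p \<in> push_max ` ?P \<union> glue ` ?Q"
  then consider B where "B \<in> ?P" "p = push_max B" | A C where "(A, C) \<in> ?Q" "p = glue (A, C)" by auto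
  then show "p \<in> wt_class k j r"
  proof cases
    case 1
    then have B: "is_perm B" "good B" "r = (j choose (k - 1)) + wt k j B"
      by (auto simp: wt_class_def AvN_def wt_Nil is_perm_def good_def split: if_splits)
    then show ?thesis using 1 push_max_props(1)[OF B(1,2)] wt_push_max[OF B(1,2) k] by (simp add: wt_class_def)
  next
    case 2
    then have AC: "A \<in> AvN" "C \<in> AvN" "r = wt k (Suc j) A + wt k j C" by (auto simp: wt_class_def)
    then show ?thesis using 2 glue_props(1)[OF AC(1,2)] wt_glue[OF AC(1,2) k] by (simp add: wt_class_def)
  qed
qed

lemma product_has_sum:
  "((\<lambda>(A, C). x ^ length A * x ^ length C) has_sum fps_nth (gf k x i) s * fps_nth (gf k x j) r)
     (wt_class k i s \<times> wt_class k j r)"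
proof -
  define f :: "nat list \<times> nat list \<Rightarrow> real" where "f = (\<lambda>(A, C). x ^ length A * x ^ length C)"
  have inner: "((\<lambda>C. f (A, C)) has_sum x ^ length A * fps_nth (gf k x j) r) (wt_class k j r)" for A
    unfolding f_def using has_sum_cmult_right[OF gf_has_sum] by simp
  have outer: "((\<lambda>A. x ^ length A * fps_nth (gf k x j) r) has_sum
      fps_nth (gf k x i) s * fps_nth (gf k x j) r) (wt_class k i s)"
    by (rule has_sum_cmult_left[OF gf_has_sum])
  have "f summable_on wt_class k i s \<times> wt_class k j r"
  proof (rule summable_on_SigmaI)
    show "((\<lambda>C. f (A, C)) has_sum x ^ length A * fps_nth (gf k x j) r) (wt_class k j r)" for A
      by (rule inner)
  qed (use x has_sum_imp_summable[OF outer] in \<open>auto simp: f_def\<close>)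
  then show ?thesis
    unfolding f_def[symmetric] by (intro has_sum_SigmaI[OF _ outer] inner)
qed

text \<open>The continued fraction with its denominator cleared, as the bijection delivers it: the
  first summand comes from \<open>push_max\<close>, the second from \<open>glue\<close>.\<close>

lemma gf_rec:
  "gf k x j = fps_const x * fps_X ^ (j choose (k - 1)) * (1 + gf k x j) + gf k x (Suc j) * gf k x j"
proof (rule fps_ext)
  fix r
  let ?c = "j choose (k - 1)"
  let ?f = "\<lambda>p :: nat list. x ^ length p"
  let ?P1 = "if r = ?c then {[]} else {} :: nat list set"
  let ?P2 = "if ?c \<le> r then wt_class k j (r - ?c) else {}"
  let ?Q = "\<lambda>s. wt_class k (Suc j) s \<times> wt_class k j (r - s)"
  have "(?f has_sum (if r = ?c then 1 else 0)) ?P1"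
    by (auto intro: has_sum_finiteI)
  moreover have "(?f has_sum (if ?c \<le> r then fps_nth (gf k x j) (r - ?c) else 0)) ?P2"
    using gf_has_sum by auto
  moreover have "?P1 \<inter> ?P2 = {}" by (auto simp: wt_class_def AvN_def)
  ultimately have "(?f has_sum ((if r = ?c then 1 else 0) +
      (if ?c \<le> r then fps_nth (gf k x j) (r - ?c) else 0))) (?P1 \<union> ?P2)"
    by (rule has_sum_Un_disjoint)
  then have "((\<lambda>B. x * ?f B) has_sum (x * ((if r = ?c then 1 else 0) +
      (if ?c \<le> r then fps_nth (gf k x j) (r - ?c) else 0)))) (?P1 \<union> ?P2)"
    by (rule has_sum_cmult_right)
  moreover have "inj_on push_max (?P1 \<union> ?P2)" by (rule inj_on_subset[OF inj_push_max]) simp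
  moreover have "?f \<circ> push_max = (\<lambda>B. x * ?f B)" by (auto simp: push_max_def)
  ultimately have 1: "(?f has_sum (x * ((if r = ?c then 1 else 0) +
      (if ?c \<le> r then fps_nth (gf k x j) (r - ?c) else 0)))) (push_max ` (?P1 \<union> ?P2))"
    by (simp only: has_sum_reindex)
  have "((\<lambda>(A, C). ?f A * ?f C) has_sum (\<Sum>s\<in>{..r}. fps_nth (gf k x (Suc j)) s * fps_nth (gf k x j) (r - s)))
      (\<Union>s\<in>{..r}. ?Q s)"
  proof (rule sum_has_sum)
    show "?Q s \<inter> ?Q s' = {}" if "s \<noteq> s'" for s s' using that by (auto simp: wt_class_def)
  qed (simp_all add: product_has_sum)
  moreover have "((\<lambda>(A, C). ?f A * ?f C) has_sum S) (\<Union>s\<in>{..r}. ?Q s) \<longleftrightarrow>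
      ((?f \<circ> glue) has_sum S) (\<Union>s\<in>{..r}. ?Q s)" for S
    by (rule has_sum_cong) (auto simp: wt_class_def glue_props(2) power_add)
  moreover have "inj_on glue (\<Union>s\<in>{..r}. ?Q s)"
    by (rule inj_on_subset[OF inj_glue]) (auto simp: wt_class_def)
  ultimately have 2: "(?f has_sum (\<Sum>s\<in>{..r}. fps_nth (gf k x (Suc j)) s * fps_nth (gf k x j) (r - s)))
      (glue ` (\<Union>s\<in>{..r}. ?Q s))"
    by (simp only: has_sum_reindex)
  have "push_max ` (?P1 \<union> ?P2) \<inter> glue ` (\<Union>s\<in>{..r}. ?Q s) = {}"
  proof -
    have "is_perm B" if "B \<in> ?P1 \<union> ?P2" for B
      using that by (auto simp: wt_class_def AvN_def is_perm_def split: if_splits)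
    moreover have "A \<in> AvN \<and> C \<in> AvN" if "(A, C) \<in> (\<Union>s\<in>{..r}. ?Q s)" for A C
      using that by (auto simp: wt_class_def)
    ultimately show ?thesis using push_max_neq_glue by fast
  qed
  from has_sum_Un_disjoint[OF 1 2 this] have "fps_nth (gf k x j) r = x * ((if r = ?c then 1 else 0) +
      (if ?c \<le> r then fps_nth (gf k x j) (r - ?c) else 0)) +
      (\<Sum>s\<in>{..r}. fps_nth (gf k x (Suc j)) s * fps_nth (gf k x j) (r - s))"
    unfolding wt_class_decomp[symmetric] by (rule has_sum_unique[OF gf_has_sum])
  then show "fps_nth (gf k x j) r =
      fps_nth (fps_const x * fps_X ^ ?c * (1 + gf k x j) + gf k x (Suc j) * gf k x j) r"
    by (auto simp: mult.assoc fps_X_power_mult_nth fps_mult_nth[of "gf k x (Suc j)"] atLeast0AtMost)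
qed

lemma gf_nth_eq_0:
  assumes "r < j choose (k - 1)"
  shows "fps_nth (gf k x j) r = 0"
proof -
  have "wt_class k j r = {}" using wt_ge[OF _ k, of _ j] assms by (fastforce simp: wt_class_def)
  then show ?thesis by (simp add: gf_def)
qed

text \<open>The permutations of weight r are grouped by length. For r >= 1 the empty permutation,
  which \<open>wt_class\<close> leaves out, is not counted on the left either.\<close>

lemma coeff_count_sums:
  assumes "r \<ge> 1"
  shows "(\<lambda>n. real (coeff_count k r n) * x ^ n) sums fps_nth (gf k x 0) r"
proof -
  let ?A = "\<lambda>n. {p \<in> Av_1243_2143. length p = n \<and> inc_count k p = r}"
  have Av: "p \<in> Av_1243_2143 \<and> inc_count k p = r \<longleftrightarrow> p \<in> wt_class k 0 r" for p
  proof -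
    have "inc_count k p = wt k 0 p" if "is_perm p"
      using that k by (simp add: inc_count_eq_card_incs perm_set(2) wt_0)
    then show ?thesis
      using assms by (cases "p = []") (auto simp: Av_iff_good wt_class_def AvN_def wt_Nil)
  qed
  have "(\<lambda>p. (length p, p)) ` wt_class k 0 r = Sigma UNIV ?A"
    using Av by (auto simp: image_iff)
  moreover have "((\<lambda>(n, p). x ^ n) has_sum fps_nth (gf k x 0) r) ((\<lambda>p. (length p, p)) ` wt_class k 0 r)"
    by (subst has_sum_reindex) (auto simp: inj_on_def o_def gf_has_sum)
  ultimately have "((\<lambda>(n, p). x ^ n) has_sum fps_nth (gf k x 0) r) (Sigma UNIV ?A)"
    by simp
  then have "((\<lambda>n. real (coeff_count k r n) * x ^ n) has_sum fps_nth (gf k x 0) r) UNIV"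
  proof -
    assume *: "((\<lambda>(n, p). x ^ n) has_sum fps_nth (gf k x 0) r) (Sigma UNIV ?A)"
    have "((\<lambda>p. case (n, p) of (n, p) \<Rightarrow> x ^ n) has_sum real (coeff_count k r n) * x ^ n) (?A n)" for n
    proof -
      have "finite (?A n)"
        by (rule finite_subset[OF _ finite_perms[of n]]) (auto simp: Av_iff_good)
      then show ?thesis by (intro has_sum_finiteI) (simp_all add: coeff_count_def)
    qed
    then show ?thesis by (intro has_sum_SigmaD[OF *])
  qed
  then show ?thesis by (rule has_sum_imp_sums)
qed

end

subsection \<open>Expanding powers of a continued fraction\<close>

text \<open>The expansion of (1 - X)^(-l). The integer top covers l = 0 as well, where the
  coefficient for s = 0 has top -1.\<close>

definition neg_binomial_series :: "nat \<Rightarrow> real fps" where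
  "neg_binomial_series l = Abs_fps (\<lambda>s. binomZ (int l + int s - 1) s)"

lemma neg_binomial_series_0: "neg_binomial_series 0 = 1"
proof (rule fps_ext)
  fix s
  show "fps_nth (neg_binomial_series 0) s = fps_nth 1 s"
  proof (cases s)
    case (Suc s')
    have "real_of_int (int s - 1) gchoose s = real (s' choose s)"
      by (simp add: Suc binomial_gbinomial)
    then show ?thesis by (simp add: neg_binomial_series_def binomZ_def Suc)
  qed (simp add: neg_binomial_series_def binomZ_def)
qed

lemma neg_binomial_series_Suc: "neg_binomial_series (Suc l) * (1 - fps_X) = neg_binomial_series l"
proof (rule fps_ext)
  fix s
  show "fps_nth (neg_binomial_series (Suc l) * (1 - fps_X)) s = fps_nth (neg_binomial_series l) s"
  proof (cases s)
    case 0
    then show ?thesis by (simp add: neg_binomial_series_def binomZ_def)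
  next
    case (Suc s')
    have "(real l + real s' + 1) gchoose Suc s' = ((real l + real s') gchoose s') + ((real l + real s') gchoose Suc s')"
      by (rule gbinomial_Suc_Suc)
    then show ?thesis
      by (simp add: neg_binomial_series_def binomZ_def Suc right_diff_distrib algebra_simps)
  qed
qed

lemma neg_binomial_series_compose:
  fixes z :: "real fps"
  assumes "fps_nth z 0 = 0"
  shows "(neg_binomial_series l oo z) * (1 - z) ^ l = 1"
proof (induction l)
  case 0
  then show ?case by (simp add: neg_binomial_series_0)
next
  case (Suc l)
  have "(neg_binomial_series (Suc l) oo z) * (1 - z) = neg_binomial_series (Suc l) * (1 - fps_X) oo z"
    using assms by (simp add: fps_compose_mult_distrib fps_compose_sub_distrib fps_X_fps_compose_startby0)
  also have "\<dots> = neg_binomial_series l oo z" by (simp only: neg_binomial_series_Suc)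
  finally show ?case using Suc by (simp only: power_Suc mult.assoc[symmetric])
qed

text \<open>Powers z^s with s > n do not reach degree n, so the composition contributes a finite
  sum.\<close>

lemma fps_mult_compose_nth:
  fixes f h z :: "real fps"
  assumes "fps_nth z 0 = 0"
  shows "fps_nth (f * (h oo z)) n = (\<Sum>s\<le>n. fps_nth h s * fps_nth (f * z ^ s) n)"
proof -
  have "fps_nth (h oo z) m = (\<Sum>s\<le>n. fps_nth h s * fps_nth (z ^ s) m)" if "m \<le> n" for m
    unfolding fps_compose_nth
    by (rule sum.mono_neutral_left)
       (use that startsby_zero_power_prefix[OF assms] in auto)
  then have "fps_nth (f * (h oo z)) n =
      (\<Sum>i=0..n. fps_nth f i * (\<Sum>s\<le>n. fps_nth h s * fps_nth (z ^ s) (n - i)))"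
    by (simp add: fps_mult_nth)
  also have "\<dots> = (\<Sum>s\<le>n. \<Sum>i=0..n. fps_nth h s * (fps_nth f i * fps_nth (z ^ s) (n - i)))"
    unfolding sum_distrib_left by (subst sum.swap) (simp add: mult_ac)
  also have "\<dots> = (\<Sum>s\<le>n. fps_nth h s * fps_nth (f * z ^ s) n)"
    by (simp add: fps_mult_nth sum_distrib_left)
  finally show ?thesis .
qed

text \<open>The coefficient of v^(l+m) t'^l' in (v / (1 - v - t'))^l: among l' + m chosen summands,
  m are v and l' are t'.\<close>

definition coef :: "nat \<Rightarrow> nat \<Rightarrow> nat \<Rightarrow> real" where
  "coef l l' m = binomZ (int l + int l' + int m - 1) (l' + m) * binomZ (int (l' + m)) m"

lemma binomZ_nat: "binomZ (int n) m = real (n choose m)"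
  by (simp add: binomZ_def binomial_gbinomial)

text \<open>For l' + m > 0 the top l' + m - 1 is a natural number smaller than the lower index, so
  the first binomial vanishes.\<close>

lemma coef_0: "coef 0 l' m \<noteq> 0 \<Longrightarrow> l' = 0 \<and> m = 0"
proof (rule ccontr)
  assume nz: "coef 0 l' m \<noteq> 0" and "\<not> (l' = 0 \<and> m = 0)"
  then have "int 0 + int l' + int m - 1 = int (l' + m - 1)" "l' + m - 1 < l' + m" by auto
  then have "binomZ (int 0 + int l' + int m - 1) (l' + m) = 0"
    by (simp only: binomZ_nat binomial_eq_0 of_nat_0)
  with nz show False by (simp add: coef_def)
qed

text \<open>Solving for t gives t = v / (1 - z) with z = v + t'. Hence t^l = v^l (1 - z)^(-l), which
  is expanded by the negative binomial series in z and then by the binomial theorem for each z^s,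
  with s = m + l'.\<close>

lemma power_expansion:
  fixes t t' v :: "real fps"
  assumes eq: "t = v * (1 + t) + t' * t" and z: "fps_nth v 0 = 0" "fps_nth t' 0 = 0"
  shows "fps_nth (t ^ l) n =
    (\<Sum>(m, l') | m + l' \<le> n. coef l l' m * fps_nth (v ^ (l + m) * t' ^ l') n)"
proof -
  let ?z = "v + t'" and ?H = "neg_binomial_series l"
  have z0: "fps_nth ?z 0 = 0" using z by simp
  have "t * (1 - ?z) = v" using eq by (simp add: algebra_simps)
  then have "(t * (1 - ?z)) ^ l = v ^ l" by simp
  then have v: "t ^ l * (1 - ?z) ^ l = v ^ l" by (simp only: power_mult_distrib)
  have "t ^ l = t ^ l * ((?H oo ?z) * (1 - ?z) ^ l)"
    by (simp only: neg_binomial_series_compose[OF z0] mult_1_right)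
  also have "\<dots> = t ^ l * (1 - ?z) ^ l * (?H oo ?z)" by (simp only: mult_ac)
  finally have "t ^ l = v ^ l * (?H oo ?z)" by (simp only: v)
  then have "fps_nth (t ^ l) n = (\<Sum>s\<le>n. fps_nth ?H s * fps_nth (v ^ l * ?z ^ s) n)"
    using fps_mult_compose_nth[OF z0] by simp
  also have "\<dots> = (\<Sum>s\<le>n. \<Sum>m\<le>s. coef l (s - m) m * fps_nth (v ^ (l + m) * t' ^ (s - m)) n)"
  proof (rule sum.cong[OF refl])
    fix s
    have "v ^ l * ?z ^ s = (\<Sum>m\<le>s. fps_const (real (s choose m)) * (v ^ (l + m) * t' ^ (s - m)))"
      unfolding binomial_ring sum_distrib_left
      by (rule sum.cong) (simp_all add: power_add fps_of_nat mult_ac)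
    then have "fps_nth (v ^ l * ?z ^ s) n = (\<Sum>m\<le>s. real (s choose m) * fps_nth (v ^ (l + m) * t' ^ (s - m)) n)"
      by (simp add: fps_sum_nth)
    moreover have "fps_nth ?H s * real (s choose m) = coef l (s - m) m" if "m \<le> s" for m
    proof -
      have "int l + int (s - m) + int m - 1 = int l + int s - 1" "s - m + m = s" using that by simp_all
      then show ?thesis
        by (simp only: coef_def neg_binomial_series_def binomZ_nat fps_nth_Abs_fps)
    qed
    ultimately show "fps_nth ?H s * fps_nth (v ^ l * ?z ^ s) n =
        (\<Sum>m\<le>s. coef l (s - m) m * fps_nth (v ^ (l + m) * t' ^ (s - m)) n)"
      by (simp add: sum_distrib_left mult.assoc[symmetric])
  qed
  also have "\<dots> = (\<Sum>(m, l') | m + l' \<le> n. coef l l' m * fps_nth (v ^ (l + m) * t' ^ l') n)"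
    by (rule sum.triangle_reindex_eq[symmetric])
  finally show ?thesis .
qed

text \<open>Choices on n successive levels from level i on, starting with l factors. For n = 0 the
  condition on \<open>lget\<close> forces l = 0, in agreement with the convention l_{b+1} =
  0.\<close>

definition seqs :: "(nat \<Rightarrow> nat) \<Rightarrow> nat \<Rightarrow> nat \<Rightarrow> nat \<Rightarrow> nat \<Rightarrow> (nat list \<times> nat list) set" where
  "seqs c i n l r = {(L, M). length L = n \<and> length M = n \<and> lget L 0 = l \<and>
     (\<Sum>j<n. (L ! j + M ! j) * c (i + j)) = r}"

definition cprod :: "nat list \<Rightarrow> nat list \<Rightarrow> real" where
  "cprod L M = (\<Prod>j<length L. coef (L ! j) (lget L (Suc j)) (M ! j))"

definition seq_term :: "real \<Rightarrow> nat list \<times> nat list \<Rightarrow> real" where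
  "seq_term x = (\<lambda>(L, M). cprod L M * x ^ (\<Sum>j<length L. L ! j + M ! j))"

lemma lget_Cons: "lget (l # L) 0 = l" "lget (l # L) (Suc j) = lget L j"
  by (simp_all add: lget_def)

lemma cprod_Cons: "cprod (l # L) (m # M) = coef l (lget L 0) m * cprod L M"
  by (simp add: cprod_def prod.lessThan_Suc_shift lget_Cons del: prod.lessThan_Suc)

lemma seq_term_Cons:
  "seq_term x (l # L, m # M) = coef l (lget L 0) m * x ^ (l + m) * seq_term x (L, M)"
  by (simp add: seq_term_def cprod_Cons sum.lessThan_Suc_shift power_add mult_ac del: sum.lessThan_Suc)

text \<open>The zero is passed down: with l = 0 a nonzero \<open>coef\<close> forces m = 0 and makes
  the next l zero too. For r >= 1 every contributing sequence therefore has l_0 > 0.\<close>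

lemma cprod_0:
  assumes "length L = length M" "lget L 0 = 0" "cprod L M \<noteq> 0"
  shows "\<forall>j<length L. L ! j = 0 \<and> M ! j = 0"
  using assms
proof (induction L M rule: list_induct2)
  case (Cons l L m M)
  then have "l = 0" and nz: "coef l (lget L 0) m \<noteq> 0" "cprod L M \<noteq> 0"
    by (auto simp: lget_Cons cprod_Cons)
  then have "lget L 0 = 0 \<and> m = 0" using coef_0 by metis
  with Cons nz \<open>l = 0\<close> show ?case by (auto simp: nth_Cons split: nat.split)
qed simp

context
  fixes c :: "nat \<Rightarrow> nat"
  assumes c_pos: "\<And>i. c i \<ge> 1"
begin

lemma seqs_le:
  assumes "(L, M) \<in> seqs c i n l r" "j < n"
  shows "L ! j + M ! j \<le> r"
proof -
  have "L ! j + M ! j \<le> (L ! j + M ! j) * c (i + j)" using c_pos[of "i + j"] by simp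
  also have "\<dots> \<le> (\<Sum>j<n. (L ! j + M ! j) * c (i + j))"
    using assms(2) by (intro member_le_sum) auto
  finally show ?thesis using assms(1) by (simp add: seqs_def)
qed

lemma finite_seqs: "finite (seqs c i n l r)"
proof -
  let ?B = "{L. set L \<subseteq> {..r} \<and> length L = n}"
  have *: "L \<in> ?B \<and> M \<in> ?B" if LM: "(L, M) \<in> seqs c i n l r" for L M
  proof -
    from LM have len: "length L = n" "length M = n" by (simp_all add: seqs_def)
    have "L ! j \<le> r" "M ! j \<le> r" if "j < n" for j
      using seqs_le[OF LM that] by simp_all
    with len show ?thesis by (auto simp: in_set_conv_nth)
  qed
  have "seqs c i n l r \<subseteq> ?B \<times> ?B"
    by (rule subrelI) (use * in simp)
  then show ?thesis by (rule finite_subset) (simp add: finite_lists_length_eq)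
qed

text \<open>Separates the choice made on level i. The range m + l' <= r is the one of
  \<open>power_expansion\<close>; it loses nothing because all values of \<open>c\<close> are
  positive.\<close>

lemma sum_seqs_Suc:
  fixes F :: "nat list \<times> nat list \<Rightarrow> real"
  shows "(\<Sum>LM\<in>seqs c i (Suc n) l r. F LM) =
    (\<Sum>(m, l') | m + l' \<le> r. if (l + m) * c i \<le> r
       then \<Sum>(L, M)\<in>seqs c (Suc i) n l' (r - (l + m) * c i). F (l # L, m # M) else 0)"
proof -
  let ?T = "{(m, l'). m + l' \<le> r}"
  let ?T' = "{(m, l'). m + l' \<le> r \<and> (l + m) * c i \<le> r}"
  let ?S = "\<lambda>(m, l'). seqs c (Suc i) n l' (r - (l + m) * c i)"
  have finT: "finite ?T" by (rule finite_subset[of _ "{..r} \<times> {..r}"]) auto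
  then have finT': "finite ?T'" by (rule rev_finite_subset) auto
  let ?h = "\<lambda>((m, l'), (L, M)). (l # L, m # M)"
  have split: "\<exists>L' m M'. L = l # L' \<and> M = m # M' \<and> m + lget L' 0 \<le> r \<and> (l + m) * c i \<le> r \<and>
      (L', M') \<in> seqs c (Suc i) n (lget L' 0) (r - (l + m) * c i)"
    if LM: "(L, M) \<in> seqs c i (Suc n) l r" for L M
  proof -
    from LM obtain L' m M' where eq: "L = l # L'" "M = m # M'" and len: "length L' = n" "length M' = n"
      by (cases L; cases M) (auto simp: seqs_def lget_Cons)
    from LM have r: "(l + m) * c i + (\<Sum>j<n. (L' ! j + M' ! j) * c (Suc i + j)) = r"
      by (simp add: seqs_def eq sum.lessThan_Suc_shift del: sum.lessThan_Suc)
    have "lget L' 0 \<le> (\<Sum>j<n. (L' ! j + M' ! j) * c (Suc i + j))"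
    proof (cases n)
      case 0
      then show ?thesis using len by (simp add: lget_def)
    next
      case (Suc n')
      have "lget L' 0 \<le> (L' ! 0 + M' ! 0) * 1" using len Suc by (simp add: lget_def)
      also have "\<dots> \<le> (L' ! 0 + M' ! 0) * c (Suc i + 0)" using c_pos by (intro mult_le_mono2)
      also have "\<dots> \<le> (\<Sum>j<n. (L' ! j + M' ! j) * c (Suc i + j))"
        using Suc by (intro member_le_sum[of 0 _ "\<lambda>j. (L' ! j + M' ! j) * c (Suc i + j)"]) auto
      finally show ?thesis .
    qed
    moreover have "m * 1 \<le> (l + m) * c i" using c_pos by (intro mult_le_mono) auto
    ultimately have le: "m + lget L' 0 \<le> r" using r by linarith
    have "(\<Sum>j<n. (L' ! j + M' ! j) * c (Suc i + j)) = r - (l + m) * c i" "(l + m) * c i \<le> r"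
      using r by linarith+
    with eq len le show ?thesis by (simp add: seqs_def)
  qed
  have inj: "inj_on ?h (Sigma ?T' ?S)"
    by (auto simp: inj_on_def seqs_def)
  have img: "?h ` Sigma ?T' ?S = seqs c i (Suc n) l r"
  proof (intro equalityI subsetI)
    fix LM assume "LM \<in> ?h ` Sigma ?T' ?S"
    then obtain m l' L M where "LM = (l # L, m # M)" and le: "(l + m) * c i \<le> r"
      and "(L, M) \<in> seqs c (Suc i) n l' (r - (l + m) * c i)"
      by auto
    then show "LM \<in> seqs c i (Suc n) l r"
      by (simp add: seqs_def lget_Cons sum.lessThan_Suc_shift del: sum.lessThan_Suc)
  next
    fix LM assume LM: "LM \<in> seqs c i (Suc n) l r"
    obtain L M where "LM = (L, M)" by (cases LM)
    with split[of L M] LM obtain L' m M' where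
      eq: "LM = (l # L', m # M')" and m: "m + lget L' 0 \<le> r" "(l + m) * c i \<le> r"
      "(L', M') \<in> seqs c (Suc i) n (lget L' 0) (r - (l + m) * c i)"
      by blast
    have "((m, lget L' 0), (L', M')) \<in> Sigma ?T' ?S" using m by simp
    moreover have "LM = ?h ((m, lget L' 0), (L', M'))" using eq by simp
    ultimately show "LM \<in> ?h ` Sigma ?T' ?S" by blast
  qed
  have "(\<Sum>LM\<in>seqs c i (Suc n) l r. F LM) = (\<Sum>q\<in>Sigma ?T' ?S. F (?h q))"
    unfolding img[symmetric] by (simp only: sum.reindex[OF inj] o_def)
  also have "\<dots> = (\<Sum>q\<in>Sigma ?T' ?S. (\<lambda>q LM. F (?h (q, LM))) (fst q) (snd q))"
    by (rule sum.cong) auto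
  also have "\<dots> = (\<Sum>q\<in>?T'. \<Sum>LM\<in>?S q. F (?h (q, LM)))"
    using finT' finite_seqs by (subst sum.Sigma) (auto simp: case_prod_unfold)
  also have "\<dots> = (\<Sum>(m, l')\<in>?T. if (l + m) * c i \<le> r
       then \<Sum>(L, M)\<in>seqs c (Suc i) n l' (r - (l + m) * c i). F (l # L, m # M) else 0)"
    by (rule sum.mono_neutral_cong_left) (use finT in \<open>auto split: if_splits intro!: sum.cong\<close>)
  finally show ?thesis .
qed

text \<open>A term reaching level \<open>i + n\<close> from level \<open>i\<close> has \<open>q\<close>-exponent at least \<open>c i + \<dots> + c (i + n)\<close>,
  so below that bound the continued fraction may be truncated.\<close>

lemma power_eq_sum_seqs:
  fixes t :: "nat \<Rightarrow> real fps" and x :: real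
  assumes rec: "\<And>i. t i = fps_const x * fps_X ^ c i * (1 + t i) + t (Suc i) * t i"
    and t0: "\<And>i r. r < c i \<Longrightarrow> fps_nth (t i) r = 0"
  assumes "l = 0 \<or> r < (\<Sum>j\<le>n. c (i + j))"
  shows "fps_nth (t i ^ l) r = (\<Sum>LM\<in>seqs c i n l r. seq_term x LM)"
  using assms(3)
proof (induction n arbitrary: i l r)
  case 0
  show ?case
  proof (cases l)
    case 0
    then have "seqs c i 0 l r = (if r = 0 then {([], [])} else {})"
      by (auto simp: seqs_def lget_def)
    then show ?thesis using 0 by (auto simp: seq_term_def cprod_def)
  next
    case (Suc l')
    then have "seqs c i 0 l r = {}" by (auto simp: seqs_def lget_def)
    \<comment> \<open>For n = 0 the assumption reads r < c i, and a positive power of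
      \<open>t i\<close> starts no earlier than \<open>t i\<close> itself.\<close>
    moreover have "fps_nth (t i ^ l) r = 0"
      using "0.prems" Suc t0[of _ i] by (auto simp: fps_mult_nth intro!: sum.neutral)
    ultimately show ?thesis by simp
  qed
next
  case (Suc n)
  let ?v = "fps_const x * fps_X ^ c i"
  have v0: "fps_nth ?v 0 = 0" using c_pos[of i] by simp
  have t0': "fps_nth (t (Suc i)) 0 = 0" using t0[of 0 "Suc i"] c_pos[of "Suc i"] by simp
  have pow: "fps_nth (?v ^ a * f) r = (if a * c i \<le> r then x ^ a * fps_nth f (r - a * c i) else 0)" for a f
    by (simp add: power_mult_distrib fps_const_power power_mult[symmetric] mult.assoc
        fps_X_power_mult_nth mult.commute[of "c i"])
  have step: "coef l l' m * (if (l + m) * c i \<le> r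
        then x ^ (l + m) * fps_nth (t (Suc i) ^ l') (r - (l + m) * c i) else 0) =
      (if (l + m) * c i \<le> r
       then \<Sum>(L, M)\<in>seqs c (Suc i) n l' (r - (l + m) * c i). seq_term x (l # L, m # M) else 0)"
    for m l'
  proof (cases "(l + m) * c i \<le> r")
    case True
    have "(\<Sum>(L, M)\<in>seqs c (Suc i) n l' (r - (l + m) * c i). seq_term x (l # L, m # M))
        = (\<Sum>LM\<in>seqs c (Suc i) n l' (r - (l + m) * c i). coef l l' m * x ^ (l + m) * seq_term x LM)"
      by (rule sum.cong) (auto simp: seq_term_Cons seqs_def)
    also have "\<dots> = coef l l' m * x ^ (l + m) *
        (\<Sum>LM\<in>seqs c (Suc i) n l' (r - (l + m) * c i). seq_term x LM)"
      by (simp add: sum_distrib_left)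
    also have "\<dots> = coef l l' m * x ^ (l + m) * fps_nth (t (Suc i) ^ l') (r - (l + m) * c i)"
    \<comment> \<open>The induction hypothesis needs l' = 0 or the bound for one level less. If l =
      0, a nonzero \<open>coef\<close> gives l' = 0; otherwise level i uses up at least
      \<open>c i\<close> of r.\<close>
    proof (cases "coef l l' m = 0")
      case False
      have "l' = 0 \<or> r - (l + m) * c i < (\<Sum>j\<le>n. c (Suc i + j))"
      proof (cases "l = 0")
        case True
        then show ?thesis using coef_0 False by auto
      next
        case l: False
        with Suc.prems have "r < c i + (\<Sum>j\<le>n. c (Suc i + j))"
          by (simp add: sum.atMost_Suc_shift del: sum.atMost_Suc)
        moreover have "1 * c i \<le> (l + m) * c i" using l by (intro mult_le_mono1) simp
        ultimately show ?thesis using True by linarith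
      qed
      from Suc.IH[OF this] show ?thesis by simp
    qed simp
    finally show ?thesis using True by simp
  qed simp
  show ?case
    unfolding power_expansion[OF rec[of i] v0 t0'] pow sum_seqs_Suc step ..
qed

end

subsection \<open>Chebyshev polynomials and the first \<open>k - 1\<close> levels\<close>

text \<open>\<open>chebV n\<close> is \<open>U\<^bsub>n - 1\<^esub>\<close>, which makes \<open>U\<^bsub>-1\<^esub> = 0\<close> available.\<close>

definition chebV :: "nat \<Rightarrow> real \<Rightarrow> real" where
  "chebV n y = (case n of 0 \<Rightarrow> 0 | Suc m \<Rightarrow> chebU m y)"

lemma chebV_simps: "chebV 0 y = 0" "chebV (Suc n) y = chebU n y"
  by (simp_all add: chebV_def)

lemma chebV_rec: "chebV (Suc (Suc n)) y = 2 * y * chebV (Suc n) y - chebV n y"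
  by (cases n) (simp_all add: chebV_simps)

text \<open>The recurrence leaves the left side unchanged when n grows by one. Up to a power of
  \<open>sqrt x\<close> it is the determinant of the Moebius transformation in
  \<open>gf_chebyshev\<close>.\<close>

lemma chebV_cassini: "chebV (Suc n) y ^ 2 - chebV (Suc (Suc n)) y * chebV n y = 1"
proof (induction n)
  case 0
  then show ?case by (simp add: chebV_simps)
next
  case (Suc n)
  have "chebV (Suc (Suc n)) y ^ 2 - chebV (Suc (Suc (Suc n))) y * chebV (Suc n) y
      = chebV (Suc (Suc n)) y * (chebV (Suc (Suc n)) y - 2 * y * chebV (Suc n) y) + chebV (Suc n) y ^ 2"
    by (simp only: chebV_rec[of "Suc n"]) (simp add: algebra_simps power2_eq_square)
  also have "chebV (Suc (Suc n)) y - 2 * y * chebV (Suc n) y = - chebV n y"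
    by (simp add: chebV_rec)
  finally show ?case using Suc by simp
qed

text \<open>Nonnegativity alone would not survive the induction, but growth by at least 1 does,
  since 2y >= 2.\<close>

lemma chebV_increasing:
  assumes "y \<ge> 1"
  shows "0 \<le> chebV n y \<and> chebV n y + 1 \<le> chebV (Suc n) y"
proof (induction n)
  case 0
  then show ?case by (simp add: chebV_simps)
next
  case (Suc n)
  then have "2 * chebV (Suc n) y \<le> 2 * y * chebV (Suc n) y"
    using assms by (intro mult_right_mono) auto
  with Suc show ?case unfolding chebV_rec by linarith
qed

lemma chebU_pos: "y \<ge> 1 \<Longrightarrow> chebU n y > 0"
  using chebV_increasing[of y n] by (simp add: chebV_simps)

text \<open>On levels below k - 1 the binomial exponent is 0, so each level applies the same map u
  -> x / (1 - x - u). The composition follows the Chebyshev recurrence because 2 y sqrt x = 1 -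
  x.\<close>

lemma gf_chebyshev:
  assumes x: "0 < x" "x \<le> 1/8" and y: "y = (1 - x) / (2 * sqrt x)" and i: "i + 1 < k"
  shows "gf k x 0 * (fps_const (sqrt x * chebV (i + 2) y) - fps_const (chebV (i + 1) y) * gf k x (i + 1)) =
    fps_const (sqrt x) * (fps_const (sqrt x * chebV (i + 1) y) - fps_const (chebV i y) * gf k x (i + 1))"
  using i
proof (induction i)
  case 0
  have "gf k x 0 = fps_const x * (1 + gf k x 0) + gf k x 1 * gf k x 0"
    using gf_rec[OF x, of k 0] 0 by (simp add: binomial_eq_0)
  then have "gf k x 0 * (1 - fps_const x - gf k x 1) = fps_const x" by (simp add: algebra_simps)
  moreover have "fps_const (sqrt x * chebV (0 + 2) y) = 1 - fps_const x"
  proof -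
    have "sqrt x * chebV (0 + 2) y = 1 - x" using x by (simp add: y chebV_simps numeral_2_eq_2)
    then show ?thesis by (simp only: fps_const_sub[symmetric] fps_const_1_eq_1)
  qed
  moreover have "chebV (0 + 1) y = 1" "chebV 0 y = 0" by (simp_all add: chebV_simps)
  moreover have "fps_const (sqrt x) * fps_const (sqrt x) = fps_const x" using x by (simp add: fps_const_mult)
  ultimately show ?case by simp
next
  case (Suc i)
  let ?s = "sqrt x" and ?S = "fps_const (sqrt x)" and ?V = "\<lambda>n. fps_const (chebV n y)"
  let ?u = "gf k x (i + 1)" and ?u' = "gf k x (i + 2)" and ?Y = "fps_const (2 * y)"
  have YS: "?Y * ?S = 1 - ?S * ?S"
  proof -
    have "2 * y * sqrt x = 1 - sqrt x * sqrt x" using x by (simp add: y)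
    then show ?thesis by (simp only: fps_const_mult fps_const_sub flip: fps_const_1_eq_1)
  qed
  have u: "?u * (1 - ?S * ?S - ?u') = ?S * ?S"
  proof -
    have "?u = fps_const x * (1 + ?u) + ?u' * ?u"
      using gf_rec[OF x, of k "i + 1"] Suc.prems by (simp add: binomial_eq_0)
    moreover have "?S * ?S = fps_const x" using x by (simp add: fps_const_mult)
    ultimately show ?thesis by (simp add: algebra_simps)
  qed
  have V: "?V (i + 3) = ?Y * ?V (i + 2) - ?V (i + 1)" "?V (i + 2) = ?Y * ?V (i + 1) - ?V i"
    using chebV_rec[of "Suc i" y] chebV_rec[of i y] by (simp_all add: numeral_2_eq_2 numeral_3_eq_3)
  have IH: "gf k x 0 * (?S * ?V (i + 2) - ?V (i + 1) * ?u) = ?S * (?S * ?V (i + 1) - ?V i * ?u)"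
    using Suc by (simp add: fps_const_mult)
  \<comment> \<open>Eliminates \<open>?u\<close> in favour of \<open>?u'\<close>. Stated for
    arbitrary a and b because numerator and denominator are transformed in the same way.\<close>
  have step: "(?S * b - a * ?u) * (1 - ?S * ?S - ?u') = ?S * (?S * (?Y * b - a) - b * ?u')" for a b
  proof -
    have "(?S * b - a * ?u) * (1 - ?S * ?S - ?u') =
        ?S * b * ((1 - ?S * ?S) - ?u') - a * (?u * (1 - ?S * ?S - ?u'))"
      by (simp only: algebra_simps)
    also have "\<dots> = ?S * b * (?Y * ?S - ?u') - a * (?S * ?S)" by (simp only: u YS)
    also have "\<dots> = ?S * (?S * (?Y * b - a) - b * ?u')" by (simp only: algebra_simps)
    finally show ?thesis .
  qed
  have "?S * (gf k x 0 * (?S * ?V (i + 3) - ?V (i + 2) * ?u')) =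
      gf k x 0 * (?S * ?V (i + 2) - ?V (i + 1) * ?u) * (1 - ?S * ?S - ?u')"
    unfolding V(1) using step[of "?V (i + 2)" "?V (i + 1)"] by (simp only: mult_ac)
  also have "\<dots> = ?S * ((?S * ?V (i + 1) - ?V i * ?u) * (1 - ?S * ?S - ?u'))"
    by (simp only: IH mult.assoc)
  also have "\<dots> = ?S * (?S * (?S * ?V (i + 2) - ?V (i + 1) * ?u'))"
    by (simp only: step V(2))
  finally have "gf k x 0 * (?S * ?V (i + 3) - ?V (i + 2) * ?u') = ?S * (?S * ?V (i + 2) - ?V (i + 1) * ?u')"
    using x by simp
  then show ?case by (simp add: numeral_2_eq_2 numeral_3_eq_3)
qed

text \<open>The expansion in u of s (s V1 - V0 u) / (s V2 - V1 u), where V0 has been eliminated by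
  V1^2 - V2 V0 = 1. From degree 1 on the coefficients are geometric; the constant term does not fit
  that pattern.\<close>

definition crossing_series :: "real \<Rightarrow> real \<Rightarrow> real \<Rightarrow> real fps" where
  "crossing_series s V1 V2 = Abs_fps (\<lambda>l. if l = 0 then s * V1 / V2 else s * V1 ^ (l - 1) / (s ^ l * V2 ^ (l + 1)))"

lemma crossing_series_eq:
  assumes "s \<noteq> 0" "V2 \<noteq> 0" "V1 ^ 2 - V2 * V0 = 1"
  shows "crossing_series s V1 V2 * (fps_const (s * V2) - fps_const V1 * fps_X) =
    fps_const s * (fps_const (s * V1) - fps_const V0 * fps_X)"
proof (rule fps_ext)
  fix n
  let ?A = "fps_nth (crossing_series s V1 V2)"
  have L: "fps_nth (crossing_series s V1 V2 * (fps_const (s * V2) - fps_const V1 * fps_X)) n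
      = ?A n * (s * V2) - (if n = 0 then 0 else ?A (n - 1) * V1)"
    by (simp add: right_diff_distrib mult.assoc[symmetric])
  have R: "fps_nth (fps_const s * (fps_const (s * V1) - fps_const V0 * fps_X)) n
      = (if n = 0 then s * (s * V1) else if n = 1 then - s * V0 else 0)"
    by (simp add: fps_X_def)
  consider "n = 0" | "n = 1" | n' where "n = Suc (Suc n')"
    by (metis One_nat_def not0_implies_Suc)
  then show "fps_nth (crossing_series s V1 V2 * (fps_const (s * V2) - fps_const V1 * fps_X)) n =
    fps_nth (fps_const s * (fps_const (s * V1) - fps_const V0 * fps_X)) n"
    unfolding L R
  proof cases
    case 1
    then show "?A n * (s * V2) - (if n = 0 then 0 else ?A (n - 1) * V1) =
        (if n = 0 then s * (s * V1) else if n = 1 then - s * V0 else 0)"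
      using assms by (simp add: crossing_series_def)
  next
    case 2
    \<comment> \<open>Degree 1 is the place where the relation between V0, V1 and V2 enters.\<close>
    have "s / V2 - s * V1 * V1 / V2 = s * (1 - V1 ^ 2) / V2"
      by (simp add: power2_eq_square diff_divide_distrib algebra_simps)
    also have "1 - V1 ^ 2 = - V2 * V0" using assms(3) by simp
    finally show "?A n * (s * V2) - (if n = 0 then 0 else ?A (n - 1) * V1) =
        (if n = 0 then s * (s * V1) else if n = 1 then - s * V0 else 0)"
      using assms 2 by (simp add: crossing_series_def)
  next
    case 3
    then show "?A n * (s * V2) - (if n = 0 then 0 else ?A (n - 1) * V1) =
        (if n = 0 then s * (s * V1) else if n = 1 then - s * V0 else 0)"
      using assms(1,2) by (cases n') (simp_all add: crossing_series_def field_simps)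
  qed
qed

text \<open>Both sides give the same product with a series whose constant term s V2 is nonzero, and
  that factor can be cancelled.\<close>

lemma gf_0_eq_compose:
  assumes x: "0 < x" "x \<le> 1/8" and y: "y = (1 - x) / (2 * sqrt x)" and k: "k \<ge> 2" and "y \<ge> 1"
  shows "gf k x 0 = crossing_series (sqrt x) (chebU (k - 2) y) (chebU (k - 1) y) oo gf k x (k - 1)"
proof -
  obtain K where K: "k = K + 2" using k by (metis add.commute le_Suc_ex)
  let ?u = "gf k x (k - 1)"
  define s V0 V1 V2 where "s = sqrt x" and "V0 = chebV K y" and "V1 = chebU (k - 2) y" and "V2 = chebU (k - 1) y"
  have V: "V1 = chebV (K + 1) y" "V2 = chebV (K + 2) y"
    by (simp_all add: V1_def V2_def K chebV_simps)
  have u0: "fps_nth ?u 0 = 0" by (rule gf_nth_eq_0) (use x k in auto)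
  have s: "s \<noteq> 0" using x by (simp add: s_def)
  have V2: "V2 \<noteq> 0" using chebU_pos[OF \<open>y \<ge> 1\<close>, of "k - 1"] by (simp add: V2_def)
  have "V1 ^ 2 - V2 * V0 = 1" using chebV_cassini[of K y] by (simp add: V V0_def)
  from arg_cong[OF crossing_series_eq[OF s V2 this], of "\<lambda>f. f oo ?u"]
  have "(crossing_series s V1 V2 oo ?u) * (fps_const (s * V2) - fps_const V1 * ?u) =
      fps_const s * (fps_const (s * V1) - fps_const V0 * ?u)"
    using u0 by (simp add: fps_compose_mult_distrib fps_compose_sub_distrib fps_X_fps_compose_startby0)
  also have "\<dots> = gf k x 0 * (fps_const (s * V2) - fps_const V1 * ?u)"
    using gf_chebyshev[OF x y, of K k] by (simp add: K V V0_def s_def)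
  finally have "(crossing_series s V1 V2 oo ?u) * (fps_const (s * V2) - fps_const V1 * ?u) =
      gf k x 0 * (fps_const (s * V2) - fps_const V1 * ?u)" .
  moreover have "fps_const (s * V2) - fps_const V1 * ?u \<noteq> 0"
  proof
    assume "fps_const (s * V2) - fps_const V1 * ?u = 0"
    from arg_cong[OF this, of "\<lambda>f. fps_nth f 0"] show False using u0 s V2 by simp
  qed
  ultimately show ?thesis by (simp add: s_def V1_def V2_def)
qed

section \<open>Matching the expansion with the sum in the theorem\<close>

lemma hockey_stick:
  assumes "k \<ge> 1"
  shows "(\<Sum>j\<le>n. (k + j - 1) choose (k - 1)) = (k + n) choose k"
proof (induction n)
  case 0
  then show ?case by simp
next
  case (Suc n)
  obtain k' where "k = Suc k'" using assms by (cases k) auto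
  with Suc show ?case by simp
qed

text \<open>The entry l_0 is free in \<open>index_seqs\<close>, but its binomial factor is 1, so it
  is at most r and the sequences can be sorted by it.\<close>

lemma index_seqs_eq:
  assumes "k \<ge> 1"
  shows "index_seqs k b r = (\<Union>l\<le>r. seqs (\<lambda>i. (k + i - 1) choose (k - 1)) 0 (b + 1) l r)"
proof -
  have "(L, M) \<in> index_seqs k b r \<longleftrightarrow>
      (\<exists>l\<le>r. (L, M) \<in> seqs (\<lambda>i. (k + i - 1) choose (k - 1)) 0 (b + 1) l r)" for L M
  proof -
    let ?s = "\<Sum>i\<le>b. (L ! i + M ! i) * ((k + i - 1) choose (k - 1))"
    have "L ! 0 \<le> (L ! 0 + M ! 0) * ((k + 0 - 1) choose (k - 1))" using assms by simp
    also have "\<dots> \<le> ?s" by (rule member_le_sum) auto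
    finally have le: "L ! 0 \<le> ?s" .
    have hd: "lget L 0 = L ! 0" if "length L = b + 1" using that by (simp add: lget_def)
    have sum: "(\<Sum>j<b + 1. (L ! j + M ! j) * ((k + (0 + j) - 1) choose (k - 1))) = ?s"
      by (simp only: Suc_eq_plus1[symmetric] lessThan_Suc_atMost add_0)
    show ?thesis
      unfolding index_seqs_def seqs_def mem_Collect_eq prod.case sum using le hd by metis
  qed
  then show ?thesis by auto
qed

text \<open>The front factors differ in form at l_0 = 0, where the exponent of U_{k-2} is -1 on the
  left and the exceptional constant term stands on the right. There the product of binomials
  vanishes, by r >= 1.\<close>

lemma rhs_term_eq:
  assumes x: "0 < x" and y: "y = (1 - x) / (2 * sqrt x)" and k: "k \<ge> 2" and r: "r \<ge> 1"
    and LM: "(L, M) \<in> index_seqs k b r"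
  shows "rhs_term k b x (L, M) =
    fps_nth (crossing_series (sqrt x) (chebU (k - 2) y) (chebU (k - 1) y)) (L ! 0) * seq_term x (L, M)"
proof -
  have len: "length L = Suc b" "length M = Suc b"
    and sum: "r = (\<Sum>i\<le>b. (L ! i + M ! i) * ((k + i - 1) choose (k - 1)))"
    using LM by (auto simp: index_seqs_def)
  have cprod: "(\<Prod>i\<le>b. binomZ (int (L!i) + int (lget L (i+1)) + int (M!i) - 1) (lget L (i+1) + M!i)
             * binomZ (int (lget L (i+1) + M!i)) (M!i)) = cprod L M"
    unfolding cprod_def len lessThan_Suc_atMost coef_def by (rule prod.cong) simp_all
  show ?thesis
  proof (cases "cprod L M = 0")
    case True
    then show ?thesis unfolding rhs_term_def seq_term_def Let_def y[symmetric] prod.case cprod by simp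
  next
    case False
    have "L ! 0 \<noteq> 0"
    proof
      assume "L ! 0 = 0"
      then have "\<forall>j<length L. L ! j = 0 \<and> M ! j = 0"
        using cprod_0[of L M] False len by (simp add: lget_def)
      then have "r = 0" unfolding sum by (intro sum.neutral) (simp add: len)
      with r show False by simp
    qed
    then obtain l where l: "L ! 0 = Suc l" by (cases "L ! 0") auto
    define N where "N = (\<Sum>j\<le>b. L ! j + M ! j)"
    have N: "(\<Sum>j\<le>b. real (L ! j + M ! j)) = real N" by (simp add: N_def)
    have "x powr ((1 - real (L ! 0)) / 2 + (\<Sum>j\<le>b. real (L ! j + M ! j))) = x powr (- (real l / 2)) * x powr real N"
      unfolding N powr_add[symmetric] by (simp add: l)
    also have "x powr (- (real l / 2)) = sqrt x / sqrt x ^ Suc l"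
    proof -
      have "x powr (real l / 2) = (x powr (1 / 2)) powr real l" by (simp add: powr_powr)
      also have "\<dots> = sqrt x ^ l" using x by (simp add: powr_half_sqrt powr_realpow)
      finally have "x powr (real l / 2) = sqrt x ^ l" .
      then show ?thesis using x by (simp add: powr_minus field_simps)
    qed
    also have "x powr real N = x ^ N" using x by (simp add: powr_realpow)
    finally have pw: "x powr ((1 - real (L ! 0)) / 2 + (\<Sum>j\<le>b. real (L ! j + M ! j))) =
      sqrt x / sqrt x ^ Suc l * x ^ N" .
    have pi: "chebU (k - 2) y powi (int (L ! 0) - 1) = chebU (k - 2) y ^ l"
      by (simp add: l)
    have "(\<Sum>j<length L. L ! j + M ! j) = N" by (simp only: len lessThan_Suc_atMost N_def)
    then have seq: "seq_term x (L, M) = cprod L M * x ^ N" by (simp only: seq_term_def prod.case)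
    have series: "fps_nth (crossing_series (sqrt x) (chebU (k - 2) y) (chebU (k - 1) y)) (L ! 0) =
        sqrt x * chebU (k - 2) y ^ l / (sqrt x ^ Suc l * chebU (k - 1) y ^ (L ! 0 + 1))"
      by (simp only: crossing_series_def fps_nth_Abs_fps l nat.distinct if_False diff_Suc_1)
    show ?thesis
      unfolding rhs_term_def Let_def y[symmetric] prod.case cprod pw pi series seq
      by (simp only: times_divide_eq_left times_divide_eq_right divide_divide_eq_left mult_ac)
  qed
qed

text \<open>From 1/8 <= 9/64 it follows that 2 sqrt x <= 3/4, which is below 7/8 <= 1 - x.\<close>

lemma chebyshev_argument_ge_1:
  assumes "0 < x" "x \<le> 1/8"
  shows "(1 - x) / (2 * sqrt x) \<ge> 1"
proof -
  have "sqrt x \<le> 3/8" by (rule real_le_lsqrt) (use assms in \<open>auto simp: power2_eq_square\<close>)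
  then show ?thesis using assms by (simp add: le_divide_eq)
qed

theorem mainTheorem4:
  fixes r k b :: nat
  assumes "r \<ge> 1" and "k \<ge> 2"
    and "(k + b) choose k \<le> r" and "r < (k + b + 1) choose k"
  shows "\<exists>\<epsilon>>0. \<forall>x::real. 0 < x \<and> x < \<epsilon> \<longrightarrow>
           (\<lambda>n. real (coeff_count k r n) * x ^ n) sums
             (\<Sum>LM\<in>index_seqs k b r. rhs_term k b x LM)"
proof (intro exI[of _ "1/8"] conjI allI impI)
  fix x :: real assume "0 < x \<and> x < 1/8"
  then have x: "0 < x" "x \<le> 1/8" by auto
  have k: "k \<ge> 1" using assms(2) by simp
  define y where "y = (1 - x) / (2 * sqrt x)"
  have y: "y \<ge> 1" unfolding y_def by (rule chebyshev_argument_ge_1[OF x])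
  \<comment> \<open>Levels are renumbered from k - 1 on, the first level at which q occurs.\<close>
  let ?c = "\<lambda>i. (k + i - 1) choose (k - 1)"
  let ?t = "\<lambda>i. gf k x (k + i - 1)"
  define A where "A = crossing_series (sqrt x) (chebU (k - 2) y) (chebU (k - 1) y)"
  have c_pos: "?c i \<ge> 1" for i using k by (simp add: Suc_le_eq)
  \<comment> \<open>Reaching level b + 1 costs at least the sum of \<open>?c j\<close> over j <= b +
    1, which is \<open>(k + b + 1) choose k\<close> by \<open>hockey_stick\<close>; so levels 0,
    ..., b suffice.\<close>
  have bound: "r < (\<Sum>j\<le>b + 1. ?c (0 + j))"
    using assms(4) hockey_stick[OF k, of "b + 1"] by (simp del: sum.atMost_Suc)
  have pow: "fps_nth (?t 0 ^ l) r = (\<Sum>LM\<in>seqs ?c 0 (b + 1) l r. seq_term x LM)" for l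
  proof (rule power_eq_sum_seqs[OF c_pos])
    show "?t i = fps_const x * fps_X ^ ?c i * (1 + ?t i) + ?t (Suc i) * ?t i" for i
      using gf_rec[OF x k, of "k + i - 1"] k by (simp add: Suc_diff_le)
    show "fps_nth (?t i) r = 0" if "r < ?c i" for i r
      using gf_nth_eq_0[OF x k that] .
    show "l = 0 \<or> r < (\<Sum>j\<le>b + 1. ?c (0 + j))" using bound by blast
  qed
  have "fps_nth (gf k x 0) r = (\<Sum>l\<le>r. fps_nth A l * fps_nth (?t 0 ^ l) r)"
    unfolding gf_0_eq_compose[OF x y_def assms(2) y] fps_compose_nth
    by (simp add: A_def atLeast0AtMost)
  also have "\<dots> = (\<Sum>l\<le>r. \<Sum>(L, M)\<in>seqs ?c 0 (b + 1) l r. rhs_term k b x (L, M))"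
  proof (rule sum.cong[OF refl])
    fix l assume l: "l \<in> {..r}"
    have "fps_nth A l * seq_term x (L, M) = rhs_term k b x (L, M)"
      if LM: "(L, M) \<in> seqs ?c 0 (b + 1) l r" for L M
    proof -
      have "L ! 0 = l" using LM by (auto simp: seqs_def lget_def)
      moreover have "(L, M) \<in> index_seqs k b r" unfolding index_seqs_eq[OF k] using LM l by blast
      ultimately show ?thesis
        using rhs_term_eq[OF x(1) y_def assms(2,1)] by (simp add: A_def)
    qed
    then show "fps_nth A l * fps_nth (?t 0 ^ l) r =
        (\<Sum>(L, M)\<in>seqs ?c 0 (b + 1) l r. rhs_term k b x (L, M))"
      unfolding pow sum_distrib_left by (intro sum.cong) auto
  qed
  also have "\<dots> = (\<Sum>LM\<in>index_seqs k b r. rhs_term k b x LM)"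
    unfolding index_seqs_eq[OF k]
  proof -
    have "finite (seqs ?c 0 (b + 1) l r)" for l by (rule finite_seqs[OF c_pos])
    moreover have "seqs ?c 0 (b + 1) l r \<inter> seqs ?c 0 (b + 1) l' r = {}" if "l \<noteq> l'" for l l'
      using that by (auto simp: seqs_def)
    ultimately show "(\<Sum>l\<le>r. \<Sum>(L, M)\<in>seqs ?c 0 (b + 1) l r. rhs_term k b x (L, M)) =
        (\<Sum>LM\<in>(\<Union>l\<le>r. seqs ?c 0 (b + 1) l r). rhs_term k b x LM)"
      by (subst sum.UNION_disjoint) (simp_all del: One_nat_def add: case_prod_unfold)
  qed
  finally show "(\<lambda>n. real (coeff_count k r n) * x ^ n) sums (\<Sum>LM\<in>index_seqs k b r. rhs_term k b x LM)"
    using coeff_count_sums[OF x k assms(1)] by simp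
qed simp

end
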